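(* Let $\mathscr{H}$ be a separable infinite-dimensional Hilbert space and let $A\in\mathscr{L}_{1,\infty}$ be such that $\lim_{j\to\infty}j\mu_j(A)$ exists (i.e., $A\in\mathscr{W}_{|1,\infty|}$). Then $|A|$ is strongly measurable, and $$\int\!\!\!\!\!\!-\;|A|=\lim_{j\to\infty}j\mu_j(A).$$
   Context: For a compact operator $T$ on $\mathscr{H}$, $\mu_j(T)$ ($j\ge 0$) is the $(j+1)$-th eigenvalue of $|T|=\sqrt{T^*T}$, in non-increasing order counted with multiplicity. $\mathscr{L}_{1,\infty}$ is the ideal of compact operators with $\mu_j(T)=O(j^{-1})$. An eigenvalue sequence of a compact operator $A$ is a sequence $(\lambda_j(A))_{j\ge0}$ converging to $0$ listing its eigenvalues, each repeated according to algebraic multiplicity (completed by $0$'s if needed), with $|\lambda_0(A)|\ge|\lambda_1(A)|\ge\cdots$. An extended limit $\lim_\omega$ is a state on the $C^*$-algebra $\ell_\infty$ of bounded complex sequences $(a_N)_{N\ge1}$ that vanishes on sequences converging to $0$. By convention $(\log N)^{-1}=0$ for $N=1$. The Dixmier trace is $\operatorname{Tr}_\omega(A)=\lim_\omega\frac{1}{\log N}\sum_{j<N}\lambda_j(A)$. $A\in\mathscr{L}_{1,\infty}$ is measurable if $\operatorname{Tr}_\omega(A)$ is independent of the extended limit; this common value is the NC integral $\int\!\!\!\!\!\!-\;A$. A trace on $\mathscr{L}_{1,\infty}$ is a linear functional vanishing on all commutators $[S,T]$ with $S$ bounded and $T\in\mathscr{L}_{1,\infty}$; it is positive if non-negative on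 positive operators, and normalized if it equals $1$ at a positive operator $T_0$ with eigenvalues $(j+1)^{-1}$, $j\ge0$ (counted with multiplicity; the choice of $T_0$ is immaterial). $A\in\mathscr{L}_{1,\infty}$ is strongly measurable if all positive normalized traces on $\mathscr{L}_{1,\infty}$ take the same value at $A$. Dixmier traces are positive normalized traces, so strong measurability implies measurability. *)

theory Defs
  imports "HOL-Analysis.Analysis" "HOL-Library.Landau_Symbols"
begin

section \<open>Complex Hilbert spaces\<close>

class complex_vector = real_vector +
  fixes scaleC :: "complex \<Rightarrow> 'a \<Rightarrow> 'a" (infixr "*\<^sub>C" 75)
  assumes scaleC_add_right: "c *\<^sub>C (x + y) = c *\<^sub>C x + c *\<^sub>C y"
    and scaleC_add_left: "(c + d) *\<^sub>C x = c *\<^sub>C x + d *\<^sub>C x"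
    and scaleC_scaleC: "c *\<^sub>C d *\<^sub>C x = (c * d) *\<^sub>C x"
    and scaleR_scaleC: "r *\<^sub>R x = complex_of_real r *\<^sub>C x"

global_interpretation complex_vector: vector_space "scaleC :: complex \<Rightarrow> 'a \<Rightarrow> 'a::complex_vector"
proof
  show "1 *\<^sub>C x = x" for x :: 'a
    using scaleR_scaleC[of 1 x] by simp
qed (simp_all add: scaleC_add_right scaleC_add_left scaleC_scaleC)

text \<open>
  The inner product is linear in the second argument. The real inner product of the superclass,
  and hence the norm and the topology, is its real part; by conjugate symmetry
  \<open>cinner x x\<close> is real, so it equals \<open>(norm x)\<^sup>2\<close> and positive definiteness is inherited from
  \<^class>\<open>real_inner\<close>.
\<close>

class complex_inner = complex_vector + real_inner +
  fixes cinner :: "'a \<Rightarrow> 'a \<Rightarrow> complex"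
  assumes cinner_commute: "cinner x y = cnj (cinner y x)"
    and cinner_add_right: "cinner x (y + z) = cinner x y + cinner x z"
    and cinner_scaleC_right: "cinner x (c *\<^sub>C y) = c * cinner x y"
    and inner_eq_Re_cinner: "inner x y = Re (cinner x y)"

class chilbert_space = complex_inner + complete_space

definition infinite_dimensional :: "'a::complex_vector itself \<Rightarrow> bool" where
  "infinite_dimensional _ \<longleftrightarrow> \<not> (\<exists>B :: 'a set. finite B \<and> complex_vector.span B = UNIV)"


section \<open>Bounded and compact operators\<close>

definition bounded_op :: "('a::complex_inner \<Rightarrow> 'a) \<Rightarrow> bool" where
  "bounded_op T \<longleftrightarrow> bounded_linear T \<and> (\<forall>c x. T (c *\<^sub>C x) = c *\<^sub>C T x)"

definition compact_op :: "('a::complex_inner \<Rightarrow> 'a) \<Rightarrow> bool" where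
  "compact_op T \<longleftrightarrow> bounded_op T \<and> compact (closure (T ` cball 0 1))"

definition positive_op :: "('a::complex_inner \<Rightarrow> 'a) \<Rightarrow> bool" where
  "positive_op T \<longleftrightarrow> bounded_op T \<and> (\<forall>x. cinner x (T x) \<in> \<real>\<^sub>\<ge>\<^sub>0)"

definition adj_op :: "('a::chilbert_space \<Rightarrow> 'a) \<Rightarrow> 'a \<Rightarrow> 'a" where
  "adj_op T = (THE S. \<forall>x y. cinner (T x) y = cinner x (S y))"

definition sqrt_op :: "('a::chilbert_space \<Rightarrow> 'a) \<Rightarrow> 'a \<Rightarrow> 'a" where
  "sqrt_op P = (THE S. positive_op S \<and> S \<circ> S = P)"

definition abs_op :: "('a::chilbert_space \<Rightarrow> 'a) \<Rightarrow> 'a \<Rightarrow> 'a" where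
  "abs_op T = sqrt_op (adj_op T \<circ> T)"


section \<open>Eigenvalue sequences and singular values\<close>

text \<open>
  The dimension of the generalized eigenspace. The library's \<open>dim\<close> is \<open>0\<close> on
  infinite-dimensional spaces, but for compact \<open>A\<close> and \<open>z \<noteq> 0\<close>, the only case used,
  this space is finite-dimensional.
\<close>

definition alg_mult :: "('a::complex_inner \<Rightarrow> 'a) \<Rightarrow> complex \<Rightarrow> nat" where
  "alg_mult A z = complex_vector.dim (\<Union>n. {x. ((\<lambda>y. A y - z *\<^sub>C y) ^^ n) x = 0})"

text \<open>
  Only nonzero values are counted: if there are finitely many nonzero eigenvalues, the sequence
  is forced to be \<open>0\<close> afterwards, and otherwise the ordering leaves no room for an entry \<open>0\<close>,
  even if \<open>0\<close> is an eigenvalue. For \<open>z \<noteq> 0\<close> the set \<open>{j. l j = z}\<close> is finite since \<open>l\<close>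
  tends to \<open>0\<close>.
\<close>

definition is_eigenvalue_seq :: "('a::complex_inner \<Rightarrow> 'a) \<Rightarrow> (nat \<Rightarrow> complex) \<Rightarrow> bool" where
  "is_eigenvalue_seq A l \<longleftrightarrow>
     l \<longlonglongrightarrow> 0 \<and> decseq (\<lambda>j. norm (l j)) \<and> (\<forall>z. z \<noteq> 0 \<longrightarrow> card {j. l j = z} = alg_mult A z)"

text \<open>
  An eigenvalue sequence of a compact operator is unique only up to the order of eigenvalues of
  equal modulus; one is fixed by choice. It is unique if \<open>A\<close> is positive.
\<close>

definition eigenvalue_seq :: "('a::complex_inner \<Rightarrow> 'a) \<Rightarrow> nat \<Rightarrow> complex" where
  "eigenvalue_seq A = (SOME l. is_eigenvalue_seq A l)"

text \<open>
  The eigenvalues of \<open>abs_op T\<close> are real and nonnegative, and since it is self-adjoint,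
  their algebraic and geometric multiplicities agree.
\<close>

definition singular_value :: "('a::chilbert_space \<Rightarrow> 'a) \<Rightarrow> nat \<Rightarrow> real" where
  "singular_value T j = Re (eigenvalue_seq (abs_op T) j)"

definition weak_trace_class :: "('a::chilbert_space \<Rightarrow> 'a) set" where
  "weak_trace_class = {T. compact_op T \<and> singular_value T \<in> O(\<lambda>j. 1 / real j)}"


section \<open>Dixmier traces and the NC integral\<close>

text \<open>
  A functional on \<open>\<ell>\<^sub>\<infinity>\<close> is a function on all complex sequences of which only the values on
  bounded sequences (\<^const>\<open>Bseq\<close>) matter. The entry of index \<open>n\<close> of such a sequence is the
  mathematical \<open>a\<^sub>N\<close> for \<open>N = n + 1\<close>.
\<close>

definition extended_limit :: "((nat \<Rightarrow> complex) \<Rightarrow> complex) \<Rightarrow> bool" where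
  "extended_limit \<omega> \<longleftrightarrow>
     (\<forall>a b. Bseq a \<longrightarrow> Bseq b \<longrightarrow> \<omega> (\<lambda>n. a n + b n) = \<omega> a + \<omega> b) \<and>
     (\<forall>c a. Bseq a \<longrightarrow> \<omega> (\<lambda>n. c * a n) = c * \<omega> a) \<and>
     (\<forall>a. Bseq a \<longrightarrow> (\<forall>n. a n \<in> \<real>\<^sub>\<ge>\<^sub>0) \<longrightarrow> \<omega> a \<in> \<real>\<^sub>\<ge>\<^sub>0) \<and>
     \<omega> (\<lambda>n. 1) = 1 \<and>
     (\<forall>a. a \<longlonglongrightarrow> 0 \<longrightarrow> \<omega> a = 0)"

text \<open>
  For \<open>N = Suc n = 1\<close> the factor is \<open>1 / ln 1 = 1 / 0 = 0\<close>, which is the usual convention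
  for \<open>1 / log N\<close>.
\<close>

definition dixmier_trace ::
  "((nat \<Rightarrow> complex) \<Rightarrow> complex) \<Rightarrow> ('a::chilbert_space \<Rightarrow> 'a) \<Rightarrow> complex" where
  "dixmier_trace \<omega> A =
     \<omega> (\<lambda>n. complex_of_real (1 / ln (real (Suc n))) * (\<Sum>j<Suc n. eigenvalue_seq A j))"

definition measurable_op :: "('a::chilbert_space \<Rightarrow> 'a) \<Rightarrow> bool" where
  "measurable_op A \<longleftrightarrow>
     A \<in> weak_trace_class \<and> (\<exists>c. \<forall>\<omega>. extended_limit \<omega> \<longrightarrow> dixmier_trace \<omega> A = c)"

definition nc_integral :: "('a::chilbert_space \<Rightarrow> 'a) \<Rightarrow> complex" where
  "nc_integral A = (THE c. \<forall>\<omega>. extended_limit \<omega> \<longrightarrow> dixmier_trace \<omega> A = c)"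


section \<open>Traces and strong measurability\<close>

text \<open>
  As above, only the values of a functional on \<^const>\<open>weak_trace_class\<close> matter.
\<close>

definition is_trace :: "(('a::chilbert_space \<Rightarrow> 'a) \<Rightarrow> complex) \<Rightarrow> bool" where
  "is_trace \<phi> \<longleftrightarrow>
     (\<forall>S\<in>weak_trace_class. \<forall>T\<in>weak_trace_class. \<phi> (\<lambda>x. S x + T x) = \<phi> S + \<phi> T) \<and>
     (\<forall>c. \<forall>T\<in>weak_trace_class. \<phi> (\<lambda>x. c *\<^sub>C T x) = c * \<phi> T) \<and>
     (\<forall>S T. bounded_op S \<longrightarrow> T \<in> weak_trace_class \<longrightarrow> \<phi> (\<lambda>x. S (T x) - T (S x)) = 0)"

definition positive_trace :: "(('a::chilbert_space \<Rightarrow> 'a) \<Rightarrow> complex) \<Rightarrow> bool" where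
  "positive_trace \<phi> \<longleftrightarrow>
     is_trace \<phi> \<and> (\<forall>T\<in>weak_trace_class. positive_op T \<longrightarrow> \<phi> T \<in> \<real>\<^sub>\<ge>\<^sub>0)"

definition normalized_trace :: "(('a::chilbert_space \<Rightarrow> 'a) \<Rightarrow> complex) \<Rightarrow> bool" where
  "normalized_trace \<phi> \<longleftrightarrow>
     is_trace \<phi> \<and>
     (\<exists>T\<^sub>0\<in>weak_trace_class. positive_op T\<^sub>0 \<and>
        is_eigenvalue_seq T\<^sub>0 (\<lambda>j. complex_of_real (1 / (real j + 1))) \<and> \<phi> T\<^sub>0 = 1)"

definition strongly_measurable_op :: "('a::chilbert_space \<Rightarrow> 'a) \<Rightarrow> bool" where
  "strongly_measurable_op A \<longleftrightarrow>
     A \<in> weak_trace_class \<and>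
     (\<exists>c. \<forall>\<phi>. positive_trace \<phi> \<longrightarrow> normalized_trace \<phi> \<longrightarrow> \<phi> A = c)"

end

theory Submission
  imports Defs
begin

text \<open>
  By the spectral theorem, \<open>|A|\<close> is diagonal in an orthonormal sequence with entries \<open>\<mu> j\<close>, the
  singular values (\<open>compact_positive_op_diagonal\<close>, \<open>sqrt_op_diag_op\<close>, \<open>abs_op_compact_diagonal\<close>), and
  \<open>j \<mu> j\<close> tends to \<open>L\<close>.

  A trace cannot distinguish operators with the same entries in different orthonormal sequences,
  because they are of the form \<open>U T\<close> and \<open>T U\<close> with a partial isometry \<open>U\<close>
  (\<open>trace_diag_op_basis_change\<close>). So a positive normalized trace \<open>\<phi>\<close> takes the value \<open>1\<close> at the operator
  with entries \<open>1 / (j + 1)\<close> in the sequence that diagonalizes \<open>|A|\<close>. It vanishes on rank one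
  projections: they all have the same trace \<open>c\<close>, and positivity bounds \<open>c\<close> times every harmonic number
  by \<open>1\<close>. As \<open>(L - \<epsilon>) / (j + 1) \<le> \<mu> j \<le> (L + \<epsilon>) / (j + 1)\<close> for all but finitely many \<open>j\<close>, positivity
  yields \<open>\<phi> |A| = L\<close> (\<open>positive_normalized_trace_diag_op\<close>).

  For these comparisons one must know that diagonal operators with nonnegative entries of size
  \<open>O(1 / j)\<close>, in any order, belong to the weak trace class. Their singular values are the decreasing
  rearrangement of the entries, controlled by counting the entries above a level
  (\<open>diag_op_weak_trace_class\<close>). In this way everything is done with diagonal operators, and no
  inequality for singular values of sums or products enters.

  The Dixmier traces of \<open>|A|\<close> are computed directly: \<open>(\<Sum>j<N. \<mu> j) / ln N\<close> converges to \<open>L\<close>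
  (\<open>log_mean\<close>), and an extended limit agrees with the limit on convergent sequences. The value of
  \<^const>\<open>nc_integral\<close>, a definite description over all extended limits, is \<open>L\<close> only because extended
  limits exist (\<open>extended_limit_exists\<close>).
\<close>

section \<open>Complex inner products\<close>

instance chilbert_space \<subseteq> banach ..

lemma cinner_add_left: "cinner (x + y) z = cinner x z + cinner y (z :: 'a::complex_inner)"
  by (simp add: cinner_commute[of _ z] cinner_add_right)

lemma cinner_scaleC_left: "cinner (c *\<^sub>C x) y = cnj c * cinner x (y :: 'a::complex_inner)"
  by (simp add: cinner_commute[of _ y] cinner_scaleC_right)

lemma cinner_scaleR_right: "cinner x (r *\<^sub>R y) = complex_of_real r * cinner x (y :: 'a::complex_inner)"
  by (simp add: scaleR_scaleC cinner_scaleC_right)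

lemma cinner_scaleR_left: "cinner (r *\<^sub>R x) y = complex_of_real r * cinner x (y :: 'a::complex_inner)"
  by (simp add: scaleR_scaleC cinner_scaleC_left)

lemma cinner_self: "cinner x x = complex_of_real ((norm (x :: 'a::complex_inner))\<^sup>2)"
proof (rule complex_eqI)
  show "Re (cinner x x) = Re (complex_of_real ((norm x)\<^sup>2))"
    by (simp add: power2_norm_eq_inner inner_eq_Re_cinner)
  have "Im (cinner x x) = - Im (cinner x x)"
    using cinner_commute[of x x] by (metis cnj.simps(2))
  then show "Im (cinner x x) = Im (complex_of_real ((norm x)\<^sup>2))" by simp
qed

lemma norm_scaleC: "norm (c *\<^sub>C x) = cmod c * norm (x :: 'a::complex_inner)"
proof -
  have "complex_of_real ((norm (c *\<^sub>C x))\<^sup>2) = cnj c * c * complex_of_real ((norm x)\<^sup>2)"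
    by (simp only: cinner_self[symmetric] cinner_scaleC_left cinner_scaleC_right mult_ac)
  also have "cnj c * c = complex_of_real ((cmod c)\<^sup>2)"
    by (metis complex_norm_square mult.commute)
  finally have "(norm (c *\<^sub>C x))\<^sup>2 = (cmod c * norm x)\<^sup>2"
    by (simp add: power_mult_distrib flip: of_real_power of_real_mult)
  then show ?thesis by (simp add: power2_eq_iff_nonneg)
qed

text \<open>
  The Cauchy--Schwarz inequality for \<^const>\<open>cinner\<close> reduces to the real one of
  \<^class>\<open>real_inner\<close> by rotating \<open>y\<close> until the inner product is real and nonnegative.
\<close>

lemma norm_cinner_le: "cmod (cinner x y) \<le> norm x * norm (y :: 'a::complex_inner)"
proof (cases "cinner x y = 0")
  case False
  define c where "c = cinner x y"
  have c: "c \<noteq> 0" using False by (simp add: c_def)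
  define u where "u = cnj c / cmod c"
  have u: "cmod u = 1" using c by (simp add: u_def norm_divide)
  have "u * c = complex_of_real (cmod c)"
    using c complex_norm_square[of c] by (simp add: u_def power2_eq_square field_simps)
  then have "cmod c = Re (cinner x (u *\<^sub>C y))"
    by (simp add: cinner_scaleC_right c_def)
  also have "\<dots> \<le> norm x * norm (u *\<^sub>C y)"
    by (simp only: inner_eq_Re_cinner[symmetric] norm_cauchy_schwarz)
  finally show ?thesis by (simp add: norm_scaleC u c_def)
qed simp

lemma bounded_linear_cinner_right: "bounded_linear (cinner (x :: 'a::complex_inner))"
  by (rule bounded_linear_intro[of _ "norm x"])
    (simp_all add: cinner_add_right cinner_scaleR_right scaleR_conv_of_real norm_cinner_le
      mult.commute[of "norm _" "norm x"])

lemma bounded_linear_cinner_left: "bounded_linear (\<lambda>x. cinner x (y :: 'a::complex_inner))"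
  by (rule bounded_linear_intro[of _ "norm y"])
    (simp_all add: cinner_add_left cinner_scaleR_left scaleR_conv_of_real norm_cinner_le)

lemma bounded_linear_scaleC_right: "bounded_linear (\<lambda>x :: 'a::complex_inner. c *\<^sub>C x)"
  by (rule bounded_linear_intro[of _ "cmod c"])
    (simp_all add: scaleC_add_right scaleR_scaleC scaleC_scaleC norm_scaleC mult.commute)

lemma bounded_linear_scaleC_left: "bounded_linear (\<lambda>c. c *\<^sub>C (x :: 'a::complex_inner))"
  by (rule bounded_linear_intro[of _ "norm x"])
    (simp_all add: scaleC_add_left scaleR_scaleC scaleC_scaleC norm_scaleC scaleR_conv_of_real)

lemmas cinner_zero_right [simp] = linear_0[OF bounded_linear.linear[OF bounded_linear_cinner_right]]
lemmas cinner_diff_right = linear_diff[OF bounded_linear.linear[OF bounded_linear_cinner_right]]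
lemmas cinner_minus_right = linear_neg[OF bounded_linear.linear[OF bounded_linear_cinner_right]]
lemmas cinner_minus_left = linear_neg[OF bounded_linear.linear[OF bounded_linear_cinner_left]]
lemmas cinner_sum_right = linear_sum[OF bounded_linear.linear[OF bounded_linear_cinner_right]]
lemmas cinner_sum_left = linear_sum[OF bounded_linear.linear[OF bounded_linear_cinner_left]]

lemma cinner_self_eq_0: "cinner x x = 0 \<longleftrightarrow> (x :: 'a::complex_inner) = 0"
  by (simp add: cinner_self)

lemma cinner_ext:
  assumes "\<And>z. cinner z x = cinner z y" shows "x = (y :: 'a::complex_inner)"
proof -
  have "cinner (x - y) (x - y) = 0" by (simp add: cinner_diff_right assms)
  then show ?thesis by (simp add: cinner_self_eq_0)
qed

lemma bounded_op_scaleC: "bounded_op T \<Longrightarrow> T (c *\<^sub>C x) = c *\<^sub>C T x"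
  by (simp add: bounded_op_def)

lemma bounded_op_linear: "bounded_op T \<Longrightarrow> bounded_linear T"
  by (simp add: bounded_op_def)

lemma bounded_op_compose: "bounded_op S \<Longrightarrow> bounded_op T \<Longrightarrow> bounded_op (S \<circ> T)"
  unfolding bounded_op_def o_def using bounded_linear_compose[of S T] by simp

section \<open>Adjoints\<close>

text \<open>
  The representing vector is the minimizer of \<open>J x = \<parallel>x\<parallel>\<^sup>2 - 2 f x\<close>. This functional is bounded below,
  the parallelogram law makes minimizing sequences Cauchy, and comparing the minimizer \<open>y\<close> with
  \<open>y + t x\<close> for the best \<open>t\<close> shows that the first variation \<open>inner y x - f x\<close> vanishes.
\<close>

lemma riesz_real:
  fixes f :: "'a::{real_inner,complete_space} \<Rightarrow> real"
  assumes f: "bounded_linear f"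
  shows "\<exists>y. \<forall>x. f x = inner y x"
proof -
  interpret f: bounded_linear f by fact
  obtain K where K: "\<And>x. norm (f x) \<le> norm x * K" using f.bounded by blast
  define J where "J x = (norm x)\<^sup>2 - 2 * f x" for x
  have lower: "- K\<^sup>2 \<le> J x" for x
  proof -
    have "f x \<le> norm x * K" using K[of x] by simp
    moreover have "0 \<le> (norm x - K)\<^sup>2" by simp
    ultimately show ?thesis by (simp add: J_def power2_eq_square algebra_simps)
  qed
  define m where "m = Inf (range J)"
  have bdd: "bdd_below (range J)" using lower by (auto simp: bdd_below_def)
  have m_le: "m \<le> J x" for x unfolding m_def using bdd by (simp add: cInf_lower)
  have "\<exists>x. J x < m + 1 / real (Suc n)" for n
    using cInf_lessD[of "range J" "m + 1 / real (Suc n)"] by (auto simp: m_def)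
  then obtain X where X: "\<And>n. J (X n) < m + 1 / real (Suc n)" by metis
  have mid: "(norm (x - y))\<^sup>2 \<le> 2 * (J x - m) + 2 * (J y - m)" for x y
  proof -
    have "(norm (x - y))\<^sup>2 = 2 * J x + 2 * J y - 4 * J ((1/2) *\<^sub>R (x + y))"
      unfolding J_def power2_norm_eq_inner
      by (simp add: inner_add_left inner_add_right inner_diff_left inner_diff_right f.scaleR f.add
          inner_commute[of y x] field_simps)
    with m_le[of "(1/2) *\<^sub>R (x + y)"] show ?thesis by simp
  qed
  have "Cauchy X"
  proof (rule metric_CauchyI)
    fix e :: real assume e: "e > 0"
    obtain N where N: "1 / real (Suc N) < e\<^sup>2 / 4"
      using e by (metis nat_approx_posE zero_less_divide_iff zero_less_numeral zero_less_power)
    have "dist (X i) (X j) < e" if "i \<ge> N" "j \<ge> N" for i j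
    proof -
      have "1 / real (Suc i) \<le> 1 / real (Suc N)" "1 / real (Suc j) \<le> 1 / real (Suc N)"
        using that by (simp_all add: frac_le)
      then have "J (X i) - m < e\<^sup>2 / 4" "J (X j) - m < e\<^sup>2 / 4"
        using X[of i] X[of j] N by linarith+
      then have "2 * (J (X i) - m) + 2 * (J (X j) - m) < 4 * (e\<^sup>2 / 4)" by argo
      then have "(norm (X i - X j))\<^sup>2 < e\<^sup>2" using mid[of "X i" "X j"] by simp
      then show ?thesis using e by (simp add: dist_norm power_less_imp_less_base)
    qed
    then show "\<exists>M. \<forall>i\<ge>M. \<forall>j\<ge>M. dist (X i) (X j) < e" by blast
  qed
  then obtain y where y: "X \<longlonglongrightarrow> y" using Cauchy_convergent convergent_def by blast
  have "(\<lambda>n. J (X n)) \<longlonglongrightarrow> J y"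
    unfolding J_def by (intro tendsto_intros y f.tendsto)
  moreover have "(\<lambda>n. m + 1 / real (Suc n)) \<longlonglongrightarrow> m + 0"
    by (intro tendsto_intros LIMSEQ_Suc lim_1_over_n)
  ultimately have "J y \<le> m + 0"
    using X by (intro LIMSEQ_le) (auto intro: less_imp_le)
  then have min: "J y \<le> J x" for x using m_le[of x] by simp
  have "f x = inner y x" for x
  proof (cases "x = 0")
    case False
    \<comment> \<open>The step \<open>t\<close> below minimizes \<open>J (y + t x)\<close>.\<close>
    define d where "d = f x - inner y x"
    define t where "t = d / (norm x)\<^sup>2"
    have nx: "(norm x)\<^sup>2 > 0" using False by simp
    have "J (y + t *\<^sub>R x) = J y + t\<^sup>2 * (norm x)\<^sup>2 - 2 * t * d"
      unfolding J_def power2_norm_eq_inner d_def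
      by (simp add: inner_add_left inner_add_right f.add f.scaleR inner_commute power2_eq_square algebra_simps)
    also have "\<dots> = J y - d\<^sup>2 / (norm x)\<^sup>2"
      using nx by (simp add: t_def power2_eq_square field_simps)
    finally have "d\<^sup>2 / (norm x)\<^sup>2 \<le> 0" using min[of "y + t *\<^sub>R x"] by linarith
    then have "d = 0" using nx by (simp add: divide_le_0_iff)
    then show ?thesis by (simp add: d_def)
  qed (simp add: f.zero)
  then show ?thesis by blast
qed

lemma adj_op_unique:
  assumes "\<And>x y. cinner (T x) y = cinner x (S y)"
  shows "adj_op T = (S :: 'a::chilbert_space \<Rightarrow> 'a)"
  unfolding adj_op_def
proof (rule the_equality)
  fix R assume "\<forall>x y. cinner (T x) y = cinner x (R y)"
  then have "cinner x (R y) = cinner x (S y)" for x y using assms[of x y] by simp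
  then show "R = S" by (intro ext cinner_ext)
qed (simp add: assms)

text \<open>
  Riesz representation is applied to the real functional \<open>x \<mapsto> inner y (T x)\<close>. This matches the real
  parts; the imaginary parts follow by replacing \<open>x\<close> with \<open>\<i> x\<close>.
\<close>

lemma cinner_adj_op:
  fixes T :: "'a::chilbert_space \<Rightarrow> 'a"
  assumes T: "bounded_op T"
  shows "cinner (T x) y = cinner x (adj_op T y)"
proof -
  have "\<exists>z. \<forall>x. inner y (T x) = inner z x" for y
    by (intro riesz_real bounded_linear_compose[OF bounded_linear_inner_right] bounded_op_linear T)
  then obtain S where S: "\<And>y x. inner y (T x) = inner (S y) x" by metis
  have "cinner (T x) y = cinner x (S y)" for x y
  proof (rule complex_eqI)
    have Re: "Re (cinner (T x) y) = Re (cinner x (S y))" for x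
      using S[of y x] by (metis inner_commute inner_eq_Re_cinner)
    then show "Re (cinner (T x) y) = Re (cinner x (S y))" .
    show "Im (cinner (T x) y) = Im (cinner x (S y))"
      using Re[of "\<i> *\<^sub>C x"] by (simp add: bounded_op_scaleC[OF T] cinner_scaleC_left)
  qed
  then show ?thesis using adj_op_unique[of T S] by simp
qed

lemma bounded_op_adj_op:
  fixes T :: "'a::chilbert_space \<Rightarrow> 'a"
  assumes T: "bounded_op T"
  shows "bounded_op (adj_op T)"
proof -
  note adj = cinner_adj_op[OF T, symmetric]
  obtain K where K: "K \<ge> 0" "\<And>x. norm (T x) \<le> norm x * K"
    using bounded_linear.nonneg_bounded[OF bounded_op_linear[OF T]] by blast
  have scale: "adj_op T (c *\<^sub>C x) = c *\<^sub>C adj_op T x" for c x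
    by (rule cinner_ext) (simp add: adj cinner_scaleC_right)
  have "bounded_linear (adj_op T)"
  proof (rule bounded_linear_intro[of _ K])
    show "adj_op T (x + y) = adj_op T x + adj_op T y" for x y
      by (rule cinner_ext) (simp add: adj cinner_add_right)
    show "adj_op T (r *\<^sub>R x) = r *\<^sub>R adj_op T x" for r x
      by (simp add: scaleR_scaleC scale)
    show "norm (adj_op T y) \<le> norm y * K" for y
    proof (cases "adj_op T y = 0")
      case False
      have "(norm (adj_op T y))\<^sup>2 = cmod (cinner (adj_op T y) (adj_op T y))"
        by (simp add: cinner_self norm_power)
      also have "\<dots> = cmod (cinner (T (adj_op T y)) y)" by (simp add: adj)
      also have "\<dots> \<le> norm (adj_op T y) * K * norm y"
        by (rule order_trans[OF norm_cinner_le mult_right_mono[OF K(2) norm_ge_zero]])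
      finally show ?thesis using False by (simp add: power2_eq_square mult.commute)
    qed (simp add: K)
  qed
  then show ?thesis using scale by (simp add: bounded_op_def)
qed

section \<open>Positive operators\<close>

text \<open>
  Polarization: the quadratic form is real at \<open>x + y\<close> and at \<open>x + \<i> y\<close>, which relates the imaginary
  and the real parts of \<open>cinner x (T y)\<close> and \<open>cinner y (T x)\<close>, respectively.
\<close>

lemma positive_op_symmetric:
  assumes "positive_op T"
  shows "cinner (T x) y = cinner x (T (y :: 'a::complex_inner))"
proof -
  have T: "bounded_op T" using assms by (simp add: positive_op_def)
  interpret T: bounded_linear T using T by (rule bounded_op_linear)
  have real: "Im (cinner z (T z)) = 0" for z
    using assms by (auto simp: positive_op_def complex_nonneg_Reals_iff)
  have "Im (cinner x (T y)) = - Im (cinner y (T x))"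
    using real[of "x + y"] real[of x] real[of y]
    by (simp add: T.add cinner_add_left cinner_add_right)
  moreover have "Re (cinner x (T y)) = Re (cinner y (T x))"
    using real[of "x + \<i> *\<^sub>C y"] real[of x] real[of y]
    by (simp add: T.add cinner_add_left cinner_add_right bounded_op_scaleC[OF T]
        cinner_scaleC_left cinner_scaleC_right)
  ultimately have "cinner x (T y) = cnj (cinner y (T x))" by (simp add: complex_eq_iff)
  then show ?thesis by (simp add: cinner_commute[of "T x" y])
qed

lemma positive_op_adj_compose:
  fixes T :: "'a::chilbert_space \<Rightarrow> 'a"
  assumes "bounded_op T"
  shows "positive_op (adj_op T \<circ> T)"
proof -
  have "cinner x ((adj_op T \<circ> T) x) = complex_of_real ((norm (T x))\<^sup>2)" for x
    by (simp only: o_apply cinner_adj_op[OF assms, symmetric] cinner_self)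
  then show ?thesis
    using assms by (simp add: positive_op_def bounded_op_compose bounded_op_adj_op
        del: of_real_power)
qed

section \<open>Diagonal operators\<close>

definition orthonormal_seq :: "(nat \<Rightarrow> 'a::complex_inner) \<Rightarrow> bool" where
  "orthonormal_seq e \<longleftrightarrow> (\<forall>i j. cinner (e i) (e j) = (if i = j then 1 else 0))"

text \<open>
  In Dirac notation this is \<open>\<Sum>k. a k |e k\<rangle>\<langle>f k|\<close>. Two different orthonormal sequences are allowed since
  with \<open>a = 1\<close> this gives the partial isometry taking \<open>f k\<close> to \<open>e k\<close>, and with \<open>a\<close> tending to
  \<open>0\<close> the singular value decomposition of a compact operator.
\<close>

definition diag_op ::
  "(nat \<Rightarrow> 'a::chilbert_space) \<Rightarrow> (nat \<Rightarrow> 'a) \<Rightarrow> (nat \<Rightarrow> real) \<Rightarrow> 'a \<Rightarrow> 'a" where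
  "diag_op e f a x = (\<Sum>k. (complex_of_real (a k) * cinner (f k) x) *\<^sub>C e k)"

lemma orthonormal_seq_cinner:
  "orthonormal_seq e \<Longrightarrow> cinner (e i) (e j) = (if i = j then 1 else 0)"
  by (simp add: orthonormal_seq_def)

lemma orthonormal_seq_norm: "orthonormal_seq e \<Longrightarrow> norm (e i) = 1"
proof -
  assume "orthonormal_seq e"
  then have "complex_of_real ((norm (e i))\<^sup>2) = 1"
    using cinner_self[of "e i"] by (simp add: orthonormal_seq_cinner)
  then have "(norm (e i))\<^sup>2 = 1" using of_real_eq_1_iff by blast
  then show ?thesis by (simp add: power2_eq_1_iff) (smt (verit) norm_ge_zero)
qed

lemma cinner_orthonormal_sum:
  assumes "orthonormal_seq e" "finite F"
  shows "cinner (e j) (\<Sum>k\<in>F. c k *\<^sub>C e k) = (if j \<in> F then c j else 0)"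
  using assms(2)
  by (simp add: cinner_sum_right cinner_scaleC_right orthonormal_seq_cinner[OF assms(1)] if_distrib
      cong: if_cong)

lemma norm_orthonormal_sum:
  assumes "orthonormal_seq e" "finite F"
  shows "(norm (\<Sum>k\<in>F. c k *\<^sub>C e k))\<^sup>2 = (\<Sum>k\<in>F. (cmod (c k))\<^sup>2)"
proof -
  have "complex_of_real ((norm (\<Sum>k\<in>F. c k *\<^sub>C e k))\<^sup>2)
      = (\<Sum>k\<in>F. cnj (c k) * cinner (e k) (\<Sum>k\<in>F. c k *\<^sub>C e k))"
    by (simp only: cinner_self[symmetric] cinner_sum_left cinner_scaleC_left)
  also have "\<dots> = (\<Sum>k\<in>F. cnj (c k) * c k)"
    by (intro sum.cong refl) (simp add: cinner_orthonormal_sum[OF assms])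
  also have "\<dots> = complex_of_real (\<Sum>k\<in>F. (cmod (c k))\<^sup>2)"
    unfolding of_real_sum by (intro sum.cong refl) (metis complex_norm_square mult.commute)
  finally show ?thesis using of_real_eq_iff by blast
qed

lemma bessel_inequality:
  assumes "orthonormal_seq e" "finite F"
  shows "(\<Sum>k\<in>F. (cmod (cinner (e k) x))\<^sup>2) \<le> (norm x)\<^sup>2"
proof -
  define p where "p = (\<Sum>k\<in>F. cinner (e k) x *\<^sub>C e k)"
  let ?s = "\<Sum>k\<in>F. (cmod (cinner (e k) x))\<^sup>2"
  have "cinner p x = (\<Sum>k\<in>F. cnj (cinner (e k) x) * cinner (e k) x)"
    by (simp add: p_def cinner_sum_left cinner_scaleC_left)
  also have "\<dots> = complex_of_real ?s"
    unfolding of_real_sum by (intro sum.cong refl) (metis complex_norm_square mult.commute)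
  finally have "inner p x = ?s" by (simp only: inner_eq_Re_cinner Re_complex_of_real)
  moreover have "(norm p)\<^sup>2 = ?s" by (simp add: p_def norm_orthonormal_sum[OF assms])
  moreover have "0 \<le> (norm (x - p))\<^sup>2" by simp
  moreover have "(norm (x - p))\<^sup>2 = (norm x)\<^sup>2 - 2 * inner p x + (norm p)\<^sup>2"
    by (simp add: power2_norm_eq_inner inner_diff_left inner_diff_right inner_commute)
  ultimately show ?thesis by linarith
qed

lemma diag_coeff_bound:
  assumes "orthonormal_seq f" "\<And>k. \<bar>a k\<bar> \<le> C" "finite F"
  shows "(\<Sum>k\<in>F. (cmod (complex_of_real (a k) * cinner (f k) x))\<^sup>2) \<le> (C * norm x)\<^sup>2"
proof -
  have C: "C \<ge> 0" using assms(2)[of 0] by linarith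
  have "(\<Sum>k\<in>F. (cmod (complex_of_real (a k) * cinner (f k) x))\<^sup>2)
      \<le> (\<Sum>k\<in>F. C\<^sup>2 * (cmod (cinner (f k) x))\<^sup>2)"
  proof (intro sum_mono)
    fix k
    have "cmod (complex_of_real (a k) * cinner (f k) x) \<le> C * cmod (cinner (f k) x)"
      by (simp add: norm_mult assms(2) mult_right_mono)
    then show "(cmod (complex_of_real (a k) * cinner (f k) x))\<^sup>2 \<le> C\<^sup>2 * (cmod (cinner (f k) x))\<^sup>2"
      unfolding power_mult_distrib[symmetric] by (rule power_mono) simp
  qed
  also have "\<dots> \<le> C\<^sup>2 * (norm x)\<^sup>2"
    unfolding sum_distrib_left[symmetric]
    by (intro mult_left_mono bessel_inequality assms) simp
  finally show ?thesis by (simp add: power_mult_distrib)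
qed

lemma Bseq_real_bound:
  assumes "Bseq (a :: nat \<Rightarrow> real)" obtains C where "\<And>k. \<bar>a k\<bar> \<le> C"
  using assms unfolding Bseq_def real_norm_def by blast

lemma Bseq_real_intro: "(\<And>k. \<bar>a k :: real\<bar> \<le> C) \<Longrightarrow> Bseq a"
  by (rule BseqI'[of _ C]) simp

text \<open>
  By Bessel's inequality the coefficients are square summable, so that the Pythagorean identity
  makes the partial sums a Cauchy sequence.
\<close>

lemma diag_op_sums:
  assumes e: "orthonormal_seq e" and f: "orthonormal_seq f" and a: "Bseq a"
  shows "(\<lambda>k. (complex_of_real (a k) * cinner (f k) x) *\<^sub>C e k) sums diag_op e f a x"
proof -
  obtain C where C: "\<And>k. \<bar>a k\<bar> \<le> C" using a by (rule Bseq_real_bound) blast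
  let ?c = "\<lambda>k. complex_of_real (a k) * cinner (f k) x"
  have summ: "summable (\<lambda>k. (cmod (?c k))\<^sup>2)"
    by (rule summableI_nonneg_bounded[of _ "(C * norm x)\<^sup>2"])
      (simp_all add: diag_coeff_bound[OF f C] del: of_real_mult)
  have "summable (\<lambda>k. ?c k *\<^sub>C e k)"
    unfolding summable_Cauchy
  proof (intro allI impI)
    fix \<epsilon> :: real assume "\<epsilon> > 0"
    then obtain N where N: "\<And>m n. m \<ge> N \<Longrightarrow> norm (\<Sum>k=m..<n. (cmod (?c k))\<^sup>2) < \<epsilon>\<^sup>2"
      using summ unfolding summable_Cauchy by (meson zero_less_power)
    have "norm (\<Sum>k=m..<n. ?c k *\<^sub>C e k) < \<epsilon>" if "m \<ge> N" for m n
    proof (rule power_less_imp_less_base)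
      show "(norm (\<Sum>k=m..<n. ?c k *\<^sub>C e k))\<^sup>2 < \<epsilon>\<^sup>2"
        unfolding norm_orthonormal_sum[OF e finite_atLeastLessThan] using N[OF that, of n] by simp
    qed (use \<open>\<epsilon> > 0\<close> in simp)
    then show "\<exists>N. \<forall>m\<ge>N. \<forall>n. norm (\<Sum>k=m..<n. ?c k *\<^sub>C e k) < \<epsilon>" by blast
  qed
  then show ?thesis unfolding diag_op_def by (rule summable_sums)
qed

lemma cinner_basis_diag_op:
  assumes "orthonormal_seq e" "orthonormal_seq f" "Bseq a"
  shows "cinner (e j) (diag_op e f a x) = complex_of_real (a j) * cinner (f j) x"
proof -
  have "(\<lambda>k. cinner (e j) ((complex_of_real (a k) * cinner (f k) x) *\<^sub>C e k))
      sums cinner (e j) (diag_op e f a x)"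
    by (intro bounded_linear.sums[OF bounded_linear_cinner_right] diag_op_sums assms)
  moreover have "(\<lambda>k. cinner (e j) ((complex_of_real (a k) * cinner (f k) x) *\<^sub>C e k))
      = (\<lambda>k. if k = j then complex_of_real (a k) * cinner (f k) x else 0)"
    by (auto simp: cinner_scaleC_right orthonormal_seq_cinner[OF assms(1)])
  moreover have "\<dots> sums (complex_of_real (a j) * cinner (f j) x)" by (rule sums_single)
  ultimately show ?thesis by (metis (no_types, lifting) sums_unique2)
qed

lemma cinner_diag_op_orthogonal:
  assumes "orthonormal_seq e" "orthonormal_seq f" "Bseq a" "\<And>k. cinner z (e k) = 0"
  shows "cinner z (diag_op e f a x) = 0"
proof -
  have "(\<lambda>k. cinner z ((complex_of_real (a k) * cinner (f k) x) *\<^sub>C e k))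
      sums cinner z (diag_op e f a x)"
    by (intro bounded_linear.sums[OF bounded_linear_cinner_right] diag_op_sums assms)
  then show ?thesis by (simp add: cinner_scaleC_right assms(4) sums_iff)
qed

lemma norm_diag_op_le:
  assumes e: "orthonormal_seq e" and f: "orthonormal_seq f" and C: "\<And>k. \<bar>a k\<bar> \<le> C"
  shows "norm (diag_op e f a x) \<le> C * norm x"
proof (rule LIMSEQ_le_const2)
  have "Bseq a" using C by (rule Bseq_real_intro)
  then show "(\<lambda>n. norm (\<Sum>k<n. (complex_of_real (a k) * cinner (f k) x) *\<^sub>C e k))
      \<longlonglongrightarrow> norm (diag_op e f a x)"
    using diag_op_sums[OF e f, of a x] by (intro tendsto_norm) (simp add: sums_def)
  have "C \<ge> 0" using C[of 0] by linarith
  have "(norm (\<Sum>k<n. (complex_of_real (a k) * cinner (f k) x) *\<^sub>C e k))\<^sup>2 \<le> (C * norm x)\<^sup>2" for n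
    unfolding norm_orthonormal_sum[OF e finite_lessThan]
    by (intro diag_coeff_bound f C finite_lessThan)
  then show "\<exists>N. \<forall>n\<ge>N. norm (\<Sum>k<n. (complex_of_real (a k) * cinner (f k) x) *\<^sub>C e k) \<le> C * norm x"
    using \<open>C \<ge> 0\<close> by (meson norm_ge_zero mult_nonneg_nonneg power2_le_imp_le)
qed

lemma diag_op_add:
  assumes "orthonormal_seq e" "orthonormal_seq f" "Bseq a" "Bseq b"
  shows "diag_op e f (\<lambda>k. a k + b k) x = diag_op e f a x + diag_op e f b x"
proof -
  have "(\<lambda>k. (complex_of_real (a k + b k) * cinner (f k) x) *\<^sub>C e k) sums (diag_op e f a x + diag_op e f b x)"
    using sums_add[OF diag_op_sums[OF assms(1,2,3), of x] diag_op_sums[OF assms(1,2,4), of x]]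
    by (simp add: scaleC_add_left[symmetric] distrib_right)
  then show ?thesis by (simp add: diag_op_def sums_iff)
qed

lemma diag_op_scale:
  assumes "orthonormal_seq e" "orthonormal_seq f" "Bseq a"
  shows "diag_op e f (\<lambda>k. r * a k) x = complex_of_real r *\<^sub>C diag_op e f a x"
proof -
  have "(\<lambda>k. (complex_of_real (r * a k) * cinner (f k) x) *\<^sub>C e k)
      sums (complex_of_real r *\<^sub>C diag_op e f a x)"
    using bounded_linear.sums[OF bounded_linear_scaleC_right diag_op_sums[OF assms, of x],
      of "complex_of_real r"]
    by (simp add: scaleC_scaleC mult.assoc)
  then show ?thesis by (simp add: diag_op_def sums_iff)
qed

lemma bounded_op_diag_op:
  assumes ef: "orthonormal_seq e" "orthonormal_seq f" and a: "Bseq a"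
  shows "bounded_op (diag_op e f a)"
proof -
  obtain C where C: "\<And>k. \<bar>a k\<bar> \<le> C" using a by (rule Bseq_real_bound) blast
  note sums = diag_op_sums[OF ef a]
  have add: "diag_op e f a (x + y) = diag_op e f a x + diag_op e f a y" for x y
    by (rule sums_unique2[OF sums])
      (use sums_add[OF sums[of x] sums[of y]] in \<open>simp add: cinner_add_right distrib_left scaleC_add_left\<close>)
  have scale: "diag_op e f a (c *\<^sub>C x) = c *\<^sub>C diag_op e f a x" for c x
    by (rule sums_unique2[OF sums])
      (use bounded_linear.sums[OF bounded_linear_scaleC_right sums[of x], of c]
        in \<open>simp add: cinner_scaleC_right scaleC_scaleC mult_ac\<close>)
  have "bounded_linear (diag_op e f a)"
  proof (rule bounded_linear_intro[of _ C])
    show "diag_op e f a (r *\<^sub>R x) = r *\<^sub>R diag_op e f a x" for r x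
      by (simp add: scaleR_scaleC scale)
    show "norm (diag_op e f a x) \<le> norm x * C" for x
      using norm_diag_op_le[of e f a C x] ef C by (simp add: mult.commute)
  qed (rule add)
  then show ?thesis by (simp add: bounded_op_def scale)
qed

text \<open>
  The outer series only sees its argument through the coefficients along \<open>f\<close>, and those of
  \<open>diag_op f g b x\<close> are explicit.
\<close>

lemma diag_op_compose:
  assumes "orthonormal_seq f" "orthonormal_seq g" "Bseq b"
  shows "diag_op e f a (diag_op f g b x) = diag_op e g (\<lambda>k. a k * b k) x"
  unfolding diag_op_def[of e] by (simp add: cinner_basis_diag_op[OF assms] mult.assoc)

lemma cinner_diag_op:
  assumes "orthonormal_seq e" "orthonormal_seq f" "Bseq a"
  shows "cinner (diag_op e f a x) y = cinner x (diag_op f e a y)"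
proof (rule sums_unique2)
  show "(\<lambda>k. cinner x ((complex_of_real (a k) * cinner (e k) y) *\<^sub>C f k)) sums cinner x (diag_op f e a y)"
    by (intro bounded_linear.sums[OF bounded_linear_cinner_right] diag_op_sums assms)
  have "(\<lambda>k. cinner ((complex_of_real (a k) * cinner (f k) x) *\<^sub>C e k) y) sums cinner (diag_op e f a x) y"
    by (intro bounded_linear.sums[OF bounded_linear_cinner_left] diag_op_sums assms)
  then show "(\<lambda>k. cinner x ((complex_of_real (a k) * cinner (e k) y) *\<^sub>C f k)) sums cinner (diag_op e f a x) y"
    by (simp add: cinner_scaleC_left cinner_scaleC_right cinner_commute[of x "f _"] mult_ac)
qed

lemma adj_op_diag_op:
  assumes "orthonormal_seq e" "orthonormal_seq f" "Bseq a"
  shows "adj_op (diag_op e f a) = diag_op f e a"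
  by (rule adj_op_unique) (rule cinner_diag_op[OF assms])

lemma Bseq_sqrt:
  assumes "Bseq a" shows "Bseq (\<lambda>k. sqrt (a k))"
proof -
  obtain C where C: "\<And>k. \<bar>a k\<bar> \<le> C" using assms by (rule Bseq_real_bound) blast
  have "norm (sqrt (a k)) \<le> sqrt C" for k
    using C[of k] real_sqrt_le_mono[of "a k" C] real_sqrt_le_mono[of "- a k" C]
    by (simp add: real_sqrt_minus abs_le_iff)
  then show ?thesis by (rule BseqI')
qed

text \<open>
  The operator is the square of the symmetric operator with the entries \<open>sqrt (a k)\<close>.
\<close>

lemma positive_op_diag_op:
  assumes e: "orthonormal_seq e" and a: "Bseq a" "\<And>k. a k \<ge> 0"
  shows "positive_op (diag_op e e a)"
proof -
  have sqrt: "Bseq (\<lambda>k. sqrt (a k))" by (rule Bseq_sqrt) fact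
  let ?R = "diag_op e e (\<lambda>k. sqrt (a k))"
  have "diag_op e e a x = ?R (?R x)" for x
    by (simp add: diag_op_compose[OF e e sqrt] a(2))
  then have "cinner x (diag_op e e a x) = complex_of_real ((norm (?R x))\<^sup>2)" for x
    by (simp only: cinner_diag_op[OF e e sqrt, symmetric] cinner_self)
  then show ?thesis
    by (simp add: positive_op_def bounded_op_diag_op[OF e e a(1)] del: of_real_power)
qed

lemma compact_finite_combinations:
  fixes e :: "nat \<Rightarrow> 'a::chilbert_space"
  shows "\<exists>L. compact L \<and> (\<forall>c. (\<forall>k. cmod (c k) \<le> C) \<longrightarrow> (\<Sum>k<N. c k *\<^sub>C e k) \<in> L)"
proof (induction N)
  case 0
  show ?case by (rule exI[of _ "{0}"]) simp
next
  case (Suc N)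
  then obtain L where L: "compact L"
    "\<And>c. (\<forall>k. cmod (c k) \<le> C) \<Longrightarrow> (\<Sum>k<N. c k *\<^sub>C e k) \<in> L" by blast
  let ?M = "(\<lambda>c. c *\<^sub>C e N) ` cball 0 C"
  have "compact ?M"
    by (intro compact_continuous_image compact_cball linear_continuous_on bounded_linear_scaleC_left)
  then have "compact {x + y | x y. x \<in> L \<and> y \<in> ?M}" using L(1) compact_sums by blast
  moreover have "(\<Sum>k<Suc N. c k *\<^sub>C e k) \<in> {x + y | x y. x \<in> L \<and> y \<in> ?M}"
    if "\<forall>k. cmod (c k) \<le> C" for c
    using L(2)[OF that] that by fastforce
  ultimately show ?case by blast
qed

text \<open>
  Cutting off \<open>a\<close> after finitely many entries changes the operator by a small amount in norm, and the
  truncated operator maps the unit ball into a compact set. Hence the image of the unit ball is totally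
  bounded.
\<close>

lemma compact_op_diag_op:
  assumes ef: "orthonormal_seq e" "orthonormal_seq f" and a: "a \<longlonglongrightarrow> 0"
  shows "compact_op (diag_op e f a)"
proof -
  have B: "Bseq a" using a convergent_imp_Bseq convergent_def by blast
  obtain C where C: "\<And>k. \<bar>a k\<bar> \<le> C" using B by (rule Bseq_real_bound) blast
  have C0: "C \<ge> 0" using C[of 0] by linarith
  let ?S = "diag_op e f a ` cball 0 1"
  have "\<exists>F. finite F \<and> closure ?S \<subseteq> (\<Union>x\<in>F. ball x \<epsilon>)" if "\<epsilon> > 0" for \<epsilon>
  proof -
    obtain N where N: "\<And>k. k \<ge> N \<Longrightarrow> \<bar>a k\<bar> < \<epsilon> / 4"
      using a[THEN LIMSEQ_D, of "\<epsilon> / 4"] \<open>\<epsilon> > 0\<close> by auto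
    obtain L where L: "compact L" "\<And>c. (\<forall>k. cmod (c k) \<le> C) \<Longrightarrow> (\<Sum>k<N. c k *\<^sub>C e k) \<in> L"
      using compact_finite_combinations[where C = C and N = N and e = e] by blast
    obtain F where F: "finite F" "L \<subseteq> (\<Union>x\<in>F. ball x (\<epsilon> / 4))"
      using L(1) \<open>\<epsilon> > 0\<close> unfolding compact_eq_totally_bounded by (metis zero_less_divide_iff zero_less_numeral)
    have "?S \<subseteq> (\<Union>x\<in>F. cball x (\<epsilon> / 2))"
    proof
      fix y assume "y \<in> ?S"
      then obtain x where x: "norm x \<le> 1" "y = diag_op e f a x" by auto
      define b where "b k = (if k < N then a k else 0)" for k
      define d where "d k = (if k < N then 0 else a k)" for k
      have bC: "\<bar>b k\<bar> \<le> C" for k using C[of k] C0 by (simp add: b_def)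
      have d4: "\<bar>d k\<bar> \<le> \<epsilon> / 4" for k using N[of k] \<open>\<epsilon> > 0\<close> by (cases "k < N") (simp_all add: d_def)
      have "Bseq b" "Bseq d" by (rule Bseq_real_intro, rule bC) (rule Bseq_real_intro, rule d4)
      then have y: "y = diag_op e f b x + diag_op e f d x"
        unfolding x(2) diag_op_add[OF ef \<open>Bseq b\<close> \<open>Bseq d\<close>, symmetric]
        by (intro arg_cong[of _ _ "\<lambda>a. diag_op e f a x"]) (auto simp: b_def d_def)
      have "diag_op e f b x = (\<Sum>k<N. (complex_of_real (b k) * cinner (f k) x) *\<^sub>C e k)"
        unfolding diag_op_def by (rule suminf_finite) (auto simp: b_def)
      moreover have "cmod (complex_of_real (b k) * cinner (f k) x) \<le> C" for k
      proof -
        have "cmod (cinner (f k) x) \<le> 1 * 1"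
          using norm_cinner_le[of "f k" x] x(1) by (simp add: orthonormal_seq_norm[OF ef(2)])
        then show ?thesis
          using mult_mono[OF bC[of k], of "cmod (cinner (f k) x)" 1] C0 by (simp add: norm_mult)
      qed
      ultimately have "diag_op e f b x \<in> L" using L(2) by simp
      then obtain z where z: "z \<in> F" "dist z (diag_op e f b x) < \<epsilon> / 4" using F(2) by auto
      have "norm (diag_op e f d x) \<le> \<epsilon> / 4 * norm x" by (rule norm_diag_op_le[OF ef d4])
      also have "\<dots> \<le> \<epsilon> / 4" using x(1) \<open>\<epsilon> > 0\<close> by (simp add: mult_left_le)
      finally have "dist (diag_op e f b x) y \<le> \<epsilon> / 4" by (simp add: y dist_norm)
      then have "dist z y \<le> \<epsilon> / 2" using z(2) dist_triangle[of z y "diag_op e f b x"] by linarith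
      then show "y \<in> (\<Union>x\<in>F. cball x (\<epsilon> / 2))" using z(1) by auto
    qed
    moreover have "closed (\<Union>x\<in>F. cball x (\<epsilon> / 2))" using F(1) by auto
    ultimately have "closure ?S \<subseteq> (\<Union>x\<in>F. cball x (\<epsilon> / 2))" by (rule closure_minimal)
    also have "\<dots> \<subseteq> (\<Union>x\<in>F. ball x \<epsilon>)" using \<open>\<epsilon> > 0\<close> by fastforce
    finally show ?thesis using F(1) by blast
  qed
  then have "compact (closure ?S)"
    by (simp add: compact_eq_totally_bounded complete_eq_closed)
  then show ?thesis by (simp add: compact_op_def bounded_op_diag_op[OF ef B])
qed

section \<open>The spectral theorem for compact positive operators\<close>

lemma compact_op_convergent_subseq:
  fixes T :: "'a::chilbert_space \<Rightarrow> 'a"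
  assumes "compact_op T" "\<And>n. norm (x n) \<le> 1"
  shows "\<exists>r l. strict_mono (r :: nat \<Rightarrow> nat) \<and> (\<lambda>n. T (x (r n))) \<longlonglongrightarrow> l"
proof -
  have cpt: "compact (closure (T ` cball 0 1))" using assms(1) by (simp add: compact_op_def)
  have "\<forall>n. T (x n) \<in> closure (T ` cball 0 1)"
    using assms(2) closure_subset by fastforce
  then obtain l r where "strict_mono (r :: nat \<Rightarrow> nat)" "((\<lambda>n. T (x n)) \<circ> r) \<longlonglongrightarrow> l"
    using seq_compactE[OF compact_imp_seq_compact[OF cpt], of "\<lambda>n. T (x n)"] by blast
  then show ?thesis by (auto simp: o_def)
qed

lemma compact_op_compose:
  fixes S T :: "'a::chilbert_space \<Rightarrow> 'a"
  assumes S: "bounded_op S" and T: "compact_op T"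
  shows "compact_op (S \<circ> T)"
proof -
  let ?K = "closure (T ` cball 0 1)"
  have K: "compact (S ` ?K)"
    using T by (intro compact_continuous_image linear_continuous_on bounded_op_linear S)
      (simp add: compact_op_def)
  have "closure ((S \<circ> T) ` cball 0 1) \<subseteq> S ` ?K"
    by (intro closure_minimal compact_imp_closed K) (use closure_subset in fastforce)
  then have "compact (closure ((S \<circ> T) ` cball 0 1))"
    using compact_Int_closed[OF K closed_closure[of "(S \<circ> T) ` cball 0 1"]]
    by (simp add: Int_absorb1)
  moreover have "bounded_op (S \<circ> T)"
    using S T by (simp add: bounded_op_compose compact_op_def)
  ultimately show ?thesis by (simp add: compact_op_def)
qed

text \<open>
  Let \<open>m\<close> be the norm of \<open>P\<close> restricted to the invariant subspace \<open>M\<close>. A sequence of unit vectors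
  along which \<open>\<parallel>P x\<parallel>\<close> tends to \<open>m\<close> satisfies \<open>P\<^sup>2 x - m\<^sup>2 x \<rightarrow> 0\<close>, and compactness extracts a limit
  \<open>v\<close> with \<open>P\<^sup>2 v = m\<^sup>2 v\<close>. Since \<open>(P - m) (P + m) v = 0\<close>, the vector \<open>P v + m v\<close> is an eigenvector
  for \<open>m\<close>, and positivity of \<open>P\<close> keeps it from vanishing if \<open>m > 0\<close>. If \<open>m = 0\<close>, any
  unit vector in \<open>M\<close> will do.
\<close>

lemma positive_op_top_eigenvector:
  fixes P :: "'a::chilbert_space \<Rightarrow> 'a"
  assumes P: "compact_op P" "positive_op P"
    and M: "subspace M" "closed M" "\<And>x. x \<in> M \<Longrightarrow> P x \<in> M" "\<exists>v\<in>M. v \<noteq> 0"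
  shows "\<exists>v\<in>M. \<exists>m\<ge>0. norm v = 1 \<and> P v = m *\<^sub>R v \<and> (\<forall>x\<in>M. norm (P x) \<le> m * norm x)"
proof -
  have bl: "bounded_linear P" using P(1) by (simp add: compact_op_def bounded_op_def)
  interpret P: bounded_linear P by (rule bl)
  have sym: "inner (P x) y = inner x (P y)" for x y
    by (simp add: inner_eq_Re_cinner positive_op_symmetric[OF P(2)])
  have pos: "inner x (P x) \<ge> 0" for x
    using P(2) by (auto simp: positive_op_def inner_eq_Re_cinner complex_nonneg_Reals_iff)
  define U where "U = {x \<in> M. norm x = 1}"
  obtain v0 where "v0 \<in> M" "v0 \<noteq> 0" using M(4) by blast
  then have v0: "v0 /\<^sub>R norm v0 \<in> U" by (simp add: U_def subspace_scale[OF M(1)])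
  obtain K where K: "\<And>x. norm (P x) \<le> norm x * K" using P.bounded by blast
  define m where "m = (SUP x\<in>U. norm (P x))"
  have bdd: "bdd_above ((\<lambda>x. norm (P x)) ` U)"
    using K by (intro bdd_aboveI[of _ K]) (auto simp: U_def, metis mult_1)
  have le_m: "norm (P x) \<le> m" if "x \<in> U" for x
    unfolding m_def by (rule cSUP_upper[OF that bdd])
  have m0: "m \<ge> 0" using le_m[OF v0] norm_ge_zero order_trans by blast
  have bound: "norm (P x) \<le> m * norm x" if "x \<in> M" for x
  proof (cases "x = 0")
    case False
    then have "x /\<^sub>R norm x \<in> U" using that by (simp add: U_def subspace_scale[OF M(1)])
    from le_m[OF this] False show ?thesis by (simp add: P.scaleR field_simps)
  qed (simp add: P.zero)
  show ?thesis
  proof (cases "m = 0")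
    case True
    then have "P (v0 /\<^sub>R norm v0) = 0" using le_m[OF v0] by simp
    then show ?thesis using v0 bound True by (intro bexI[of _ "v0 /\<^sub>R norm v0"] exI[of _ 0]) (auto simp: U_def)
  next
    case False
    then have m: "m > 0" using m0 by simp
    have "\<exists>x\<in>U. m - 1 / real (Suc n) < norm (P x)" for n
      using less_cSUP_iff[OF _ bdd, of "m - 1 / real (Suc n)"] v0 by (auto simp: m_def)
    then obtain x where x: "\<And>n. x n \<in> U" "\<And>n. m - 1 / real (Suc n) < norm (P (x n))" by metis
    have lim: "(\<lambda>n. norm (P (x n))) \<longlonglongrightarrow> m"
    proof (rule tendsto_sandwich)
      show "(\<lambda>n. m - 1 / real (Suc n)) \<longlonglongrightarrow> m"
        using tendsto_diff[OF tendsto_const[of m] LIMSEQ_Suc[OF lim_1_over_n]] by simp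
      show "\<forall>\<^sub>F n in sequentially. m - 1 / real (Suc n) \<le> norm (P (x n))"
        by (intro always_eventually allI less_imp_le x(2))
      show "\<forall>\<^sub>F n in sequentially. norm (P (x n)) \<le> m"
        by (intro always_eventually allI le_m x(1))
    qed (rule tendsto_const)
    \<comment> \<open>A maximizing sequence is asymptotically an eigenvector of \<open>P\<^sup>2\<close>.\<close>
    have defect: "(norm (P (P y) - m\<^sup>2 *\<^sub>R y))\<^sup>2 \<le> m\<^sup>2 * (m\<^sup>2 - (norm (P y))\<^sup>2)" if "y \<in> U" for y
    proof -
      have y: "y \<in> M" "norm y = 1" using that by (auto simp: U_def)
      have "(norm (P (P y) - m\<^sup>2 *\<^sub>R y))\<^sup>2
          = (norm (P (P y)))\<^sup>2 - 2 * m\<^sup>2 * inner (P (P y)) y + m\<^sup>2 * m\<^sup>2 * (norm y)\<^sup>2"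
        unfolding power2_norm_eq_inner
        by (simp add: inner_diff_left inner_diff_right inner_commute[of y "P (P y)"] algebra_simps)
      moreover have "inner (P (P y)) y = (norm (P y))\<^sup>2" by (simp add: sym power2_norm_eq_inner)
      moreover have "(norm (P (P y)))\<^sup>2 \<le> m\<^sup>2 * (norm (P y))\<^sup>2"
        unfolding power_mult_distrib[symmetric] by (intro power_mono bound M(3) y) simp
      ultimately show ?thesis by (simp add: y(2) algebra_simps)
    qed
    have "(\<lambda>n. (norm (P (P (x n)) - m\<^sup>2 *\<^sub>R x n))\<^sup>2) \<longlonglongrightarrow> 0"
    proof (rule Lim_null_comparison)
      have "(\<lambda>n. m\<^sup>2 * (m\<^sup>2 - (norm (P (x n)))\<^sup>2)) \<longlonglongrightarrow> m\<^sup>2 * (m\<^sup>2 - m\<^sup>2)"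
        by (intro tendsto_intros lim)
      then show "(\<lambda>n. m\<^sup>2 * (m\<^sup>2 - (norm (P (x n)))\<^sup>2)) \<longlonglongrightarrow> 0" by simp
    qed (use defect[OF x(1)] in simp)
    then have "(\<lambda>n. sqrt ((norm (P (P (x n)) - m\<^sup>2 *\<^sub>R x n))\<^sup>2)) \<longlonglongrightarrow> sqrt 0"
      by (rule tendsto_real_sqrt)
    \<comment> \<open>The defect tends to \<open>0\<close>, so \<open>x (r n)\<close> itself converges along a subsequence where \<open>P x\<close> does.\<close>
    then have diff: "(\<lambda>n. P (P (x n)) - m\<^sup>2 *\<^sub>R x n) \<longlonglongrightarrow> 0"
      by (simp add: tendsto_norm_zero_iff)
    obtain r l where r: "strict_mono r" and l: "(\<lambda>n. P (x (r n))) \<longlonglongrightarrow> l"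
      using compact_op_convergent_subseq[OF P(1), of x] x(1) by (auto simp: U_def)
    have "(\<lambda>n. P (P (x (r n))) - (P (P (x (r n))) - m\<^sup>2 *\<^sub>R x (r n))) \<longlonglongrightarrow> P l - 0"
      using LIMSEQ_subseq_LIMSEQ[OF diff r] by (intro tendsto_diff P.tendsto l) (simp add: o_def)
    then have "(\<lambda>n. (1 / m\<^sup>2) *\<^sub>R (m\<^sup>2 *\<^sub>R x (r n))) \<longlonglongrightarrow> (1 / m\<^sup>2) *\<^sub>R P l"
      by (intro tendsto_scaleR tendsto_const) simp
    then have xr: "(\<lambda>n. x (r n)) \<longlonglongrightarrow> (1 / m\<^sup>2) *\<^sub>R P l" using m by simp
    define v where "v = (1 / m\<^sup>2) *\<^sub>R P l"
    have "l = P v"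
      using LIMSEQ_unique[OF l P.tendsto[OF xr]] by (simp add: v_def)
    then have PPv: "P (P v) = m\<^sup>2 *\<^sub>R v" using m by (simp add: v_def)
    have vM: "v \<in> M"
      using closed_sequentially[OF M(2) _ xr] x(1) by (auto simp: U_def v_def)
    have nv: "norm v = 1"
    proof (rule LIMSEQ_unique)
      show "(\<lambda>n. norm (x (r n))) \<longlonglongrightarrow> norm v" unfolding v_def by (rule tendsto_norm[OF xr])
      show "(\<lambda>n. norm (x (r n))) \<longlonglongrightarrow> 1" using x(1) by (simp add: U_def)
    qed
    define w where "w = P v + m *\<^sub>R v"
    have wM: "w \<in> M" by (simp add: w_def vM M subspace_add subspace_scale)
    have Pw: "P w = m *\<^sub>R w"
      by (simp add: w_def P.add P.scaleR PPv power2_eq_square scaleR_add_right)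
    have "inner v w = inner v (P v) + m"
      using nv by (simp add: w_def inner_add_right norm_eq_1)
    then have "w \<noteq> 0" using pos[of v] m by auto
    then show ?thesis using m0 bound wM Pw M(1)
      by (intro bexI[of _ "w /\<^sub>R norm w"] exI[of _ m]) (auto simp: P.scaleR subspace_scale)
  qed
qed

text \<open>
  Subtracting from \<open>x\<close> its projection leaves a vector orthogonal to all \<open>f i\<close>. If these vectors were
  all \<open>0\<close>, then finitely many \<open>f i\<close> would span the space.
\<close>

lemma orthogonal_vector_exists:
  fixes f :: "nat \<Rightarrow> 'a::chilbert_space"
  assumes inf: "infinite_dimensional TYPE('a)"
    and on: "\<And>i j. i < n \<Longrightarrow> j < n \<Longrightarrow> cinner (f i) (f j) = (if i = j then 1 else 0)"
  shows "\<exists>v. (\<forall>i<n. cinner (f i) v = 0) \<and> v \<noteq> 0"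
proof (rule ccontr)
  assume none: "\<not> ?thesis"
  have "x \<in> complex_vector.span (f ` {..<n})" for x
  proof -
    define p where "p = (\<Sum>j<n. cinner (f j) x *\<^sub>C f j)"
    have "cinner (f i) p = cinner (f i) x" if "i < n" for i
    proof -
      have "cinner (f i) p = (\<Sum>j<n. if j = i then cinner (f j) x else 0)"
        unfolding p_def cinner_sum_right using that
        by (intro sum.cong) (auto simp: cinner_scaleC_right on)
      then show ?thesis using that by simp
    qed
    then have "\<forall>i<n. cinner (f i) (x - p) = 0" by (simp add: cinner_diff_right)
    then have "x = p" using none by (metis right_minus_eq)
    moreover have "p \<in> complex_vector.span (f ` {..<n})"
      unfolding p_def
      by (intro complex_vector.span_sum complex_vector.span_scale complex_vector.span_base) auto
    ultimately show ?thesis by simp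
  qed
  then have "complex_vector.span (f ` {..<n}) = UNIV" by blast
  then show False using inf unfolding infinite_dimensional_def by blast
qed

text \<open>
  The sequence \<open>e\<close> is chosen greedily: \<open>e n\<close> is an eigenvector for the norm of \<open>P\<close> on the orthogonal
  complement of the earlier vectors. In infinite dimension this complement never becomes trivial, so
  the choice also goes on, with eigenvalue \<open>0\<close>, when \<open>P\<close> has finite rank. The eigenvalues decrease
  by construction. What \<open>P\<close> does outside the span of the first \<open>n\<close> vectors is bounded by \<open>a n\<close>,
  which yields the expansion of \<open>P\<close>.
\<close>

theorem compact_positive_op_diagonal:
  fixes P :: "'a::chilbert_space \<Rightarrow> 'a"
  assumes inf: "infinite_dimensional TYPE('a)" and P: "compact_op P" "positive_op P"
  shows "\<exists>e a. orthonormal_seq e \<and> decseq a \<and> (\<forall>k. a k \<ge> 0) \<and> a \<longlonglongrightarrow> 0 \<and> P = diag_op e e a"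
proof -
  have bo: "bounded_op P" using P(1) by (simp add: compact_op_def)
  interpret P: bounded_linear P using bo by (rule bounded_op_linear)
  define M where "M f n = {x. \<forall>i<n. cinner (f i :: 'a) x = 0}" for f and n :: nat
  define Q where "Q f n v \<longleftrightarrow> norm v = 1 \<and> v \<in> M f n \<and>
     (\<exists>m\<ge>0. P v = m *\<^sub>R v \<and> (\<forall>x\<in>M f n. norm (P x) \<le> m * norm x))" for f n v
  have "\<exists>e. \<forall>n. Q e n (e n)"
  proof (rule dependent_wellorder_choice)
    fix r and f g :: "nat \<Rightarrow> 'a" and n :: nat
    assume "\<And>i. i < n \<Longrightarrow> f i = g i"
    then have "M f n = M g n" by (simp add: M_def)
    then show "Q f n r = Q g n r" by (simp add: Q_def)
  next
    fix n :: nat and f :: "nat \<Rightarrow> 'a"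
    assume IH: "\<And>i. i < n \<Longrightarrow> Q f i (f i)"
    have orth: "cinner (f i) (f j) = 0" if "i < j" "j < n" for i j
      using IH[OF that(2)] that(1) by (auto simp: Q_def M_def)
    have on: "cinner (f i) (f j) = (if i = j then 1 else 0)" if "i < n" "j < n" for i j
    proof (cases i j rule: linorder_cases)
      case less then show ?thesis using orth that by simp
    next
      case equal then show ?thesis using IH[OF that(1)] by (simp add: cinner_self Q_def)
    next
      case greater
      then have "cinner (f i) (f j) = cnj 0"
        using orth[of j i] that by (simp add: cinner_commute[of "f i" "f j"])
      then show ?thesis using greater by simp
    qed
    have "subspace (M f n)"
      by (auto simp: subspace_def M_def cinner_add_right cinner_scaleR_right)
    moreover have "closed (M f n)"
    proof -
      have "M f n = (\<Inter>i\<in>{..<n}. {x. cinner (f i) x = 0})" by (auto simp: M_def)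
      then show ?thesis
        by (auto intro!: closed_Collect_eq continuous_intros
            linear_continuous_on bounded_linear_cinner_right)
    qed
    moreover have "P x \<in> M f n" if "x \<in> M f n" for x
    proof -
      have "cinner (f i) (P x) = 0" if i: "i < n" for i
      proof -
        obtain m where m: "P (f i) = m *\<^sub>R f i" using IH[OF i] by (auto simp: Q_def)
        have "cinner (f i) (P x) = cinner (P (f i)) x" by (simp add: positive_op_symmetric[OF P(2)])
        then show ?thesis using \<open>x \<in> M f n\<close> i by (simp add: m cinner_scaleR_left M_def)
      qed
      then show ?thesis by (simp add: M_def)
    qed
    moreover have "\<exists>v\<in>M f n. v \<noteq> 0"
      using orthogonal_vector_exists[OF inf on] by (auto simp: M_def)
    ultimately show "\<exists>v. Q f n v"
      using positive_op_top_eigenvector[OF P, of "M f n"] unfolding Q_def by blast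
  qed
  then obtain e where e: "\<And>n. Q e n (e n)" by blast
  define a where "a n = norm (P (e n))" for n
  have a: "P (e n) = a n *\<^sub>R e n" "\<And>x. x \<in> M e n \<Longrightarrow> norm (P x) \<le> a n * norm x" for n
    using e[of n] by (auto simp: Q_def a_def)
  have ne: "norm (e n) = 1" and eM: "e n \<in> M e n" for n using e[of n] by (auto simp: Q_def)
  have orth: "cinner (e i) (e j) = 0" if "i < j" for i j
    using eM[of j] that by (auto simp: M_def)
  have on: "orthonormal_seq e"
    unfolding orthonormal_seq_def
  proof (intro allI)
    fix i j
    show "cinner (e i) (e j) = (if i = j then 1 else 0)"
      using orth[of i j] orth[of j i] cinner_commute[of "e i" "e j"]
      by (cases i j rule: linorder_cases) (simp_all add: cinner_self ne)
  qed
  have a0: "a n \<ge> 0" for n by (simp add: a_def)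
  \<comment> \<open>The vector \<open>e (Suc n)\<close> competed in the choice of \<open>e n\<close>.\<close>
  have dec: "decseq a"
  proof (rule decseq_SucI)
    fix n
    have "e (Suc n) \<in> M e n" using eM[of "Suc n"] by (simp add: M_def)
    from a(2)[OF this] show "a (Suc n) \<le> a n" by (simp add: ne a_def)
  qed
  then obtain c where c: "a \<longlonglongrightarrow> c" "\<And>n. c \<le> a n" using a0 decseq_convergent by metis
  \<comment> \<open>By compactness, orthonormal eigenvectors cannot have eigenvalues bounded away from \<open>0\<close>.\<close>
  obtain r l where r: "strict_mono r" and l: "(\<lambda>n. P (e (r n))) \<longlonglongrightarrow> l"
    using compact_op_convergent_subseq[OF P(1), of e] ne by auto
  have "cinner (e k) l = 0" for k
  proof (rule LIMSEQ_unique)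
    show "(\<lambda>n. cinner (e k) (P (e (r n)))) \<longlonglongrightarrow> cinner (e k) l"
      by (rule bounded_linear.tendsto[OF bounded_linear_cinner_right l])
    have "\<forall>\<^sub>F n in sequentially. r n > k"
      by (rule eventually_compose_filterlim[OF eventually_gt_at_top filterlim_subseq[OF r]])
    then have "\<forall>\<^sub>F n in sequentially. cinner (e k) (P (e (r n))) = 0"
      by eventually_elim (simp add: a(1) cinner_scaleR_right orth)
    then show "(\<lambda>n. cinner (e k) (P (e (r n)))) \<longlonglongrightarrow> 0" by (rule tendsto_eventually)
  qed
  then have "cinner (P (e (r n))) l = 0" for n by (simp add: a(1) cinner_scaleR_left)
  then have "cinner l l = 0"
    using bounded_linear.tendsto[OF bounded_linear_cinner_left l, of l] by (simp add: LIMSEQ_const_iff)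
  then have "l = 0" by (simp add: cinner_self_eq_0)
  then have "(\<lambda>n. a (r n)) \<longlonglongrightarrow> 0" using tendsto_norm[OF l] by (simp add: a_def)
  moreover have "(\<lambda>n. a (r n)) \<longlonglongrightarrow> c" using LIMSEQ_subseq_LIMSEQ[OF c(1) r] by (simp add: o_def)
  ultimately have a_lim: "a \<longlonglongrightarrow> 0" using c(1) LIMSEQ_unique by blast
  then have Ba: "Bseq a" using convergent_imp_Bseq convergent_def by blast
  have "P x = diag_op e e a x" for x
  proof -
    define p where "p n = (\<Sum>k<n. cinner (e k) x *\<^sub>C e k)" for n
    have "P (p n) = (\<Sum>k<n. (complex_of_real (a k) * cinner (e k) x) *\<^sub>C e k)" for n
      by (simp add: p_def P.sum bounded_op_scaleC[OF bo] a(1) scaleR_scaleC scaleC_scaleC mult.commute)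
    then have 1: "(\<lambda>n. P (p n)) \<longlonglongrightarrow> diag_op e e a x"
      using diag_op_sums[OF on on Ba, of x] by (simp add: sums_def)
    have "norm (P x - P (p n)) \<le> a n * (2 * norm x)" for n
    proof -
      have "x - p n \<in> M e n"
        by (simp add: M_def p_def cinner_diff_right cinner_orthonormal_sum[OF on])
      then have "norm (P (x - p n)) \<le> a n * norm (x - p n)" by (rule a(2))
      also have "\<dots> \<le> a n * (2 * norm x)"
      proof (intro mult_left_mono a0)
        have "(norm (p n))\<^sup>2 \<le> (norm x)\<^sup>2"
          using bessel_inequality[OF on finite_lessThan[of n], of x]
          by (simp add: p_def norm_orthonormal_sum[OF on])
        then have "norm (p n) \<le> norm x" by (rule power2_le_imp_le) simp
        then show "norm (x - p n) \<le> 2 * norm x" using norm_triangle_ineq4[of x "p n"] by linarith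
      qed
      finally show ?thesis by (simp add: P.diff)
    qed
    moreover have "(\<lambda>n. a n * (2 * norm x)) \<longlonglongrightarrow> 0"
      using tendsto_mult_right[OF a_lim, of "2 * norm x"] by simp
    ultimately have "(\<lambda>n. P x - P (p n)) \<longlonglongrightarrow> 0"
      by (metis (no_types, lifting) Lim_null_comparison always_eventually)
    then have "(\<lambda>n. P x - (P x - P (p n))) \<longlonglongrightarrow> P x - 0" by (intro tendsto_intros)
    then have "(\<lambda>n. P (p n)) \<longlonglongrightarrow> P x" by simp
    then show ?thesis using 1 LIMSEQ_unique by blast
  qed
  then show ?thesis using on dec a0 a_lim by blast
qed

section \<open>Square roots and absolute values\<close>

lemma diag_op_apply_basis:
  assumes "orthonormal_seq e" "orthonormal_seq f"
  shows "diag_op e f a (f k) = complex_of_real (a k) *\<^sub>C e k"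
proof -
  have "diag_op e f a (f k) = (\<Sum>j. if j = k then complex_of_real (a j) *\<^sub>C e j else 0)"
    unfolding diag_op_def
    by (intro arg_cong[of _ _ suminf]) (auto simp: orthonormal_seq_cinner[OF assms(2)])
  then show ?thesis using sums_single[of k "\<lambda>j. complex_of_real (a j) *\<^sub>C e j"] by (simp add: sums_iff)
qed

lemma Bseq_one: "Bseq (\<lambda>_. 1 :: real)"
  by (rule Bseq_real_intro[of _ 1]) simp

lemma diag_op_eqI:
  fixes S :: "'a::chilbert_space \<Rightarrow> 'a"
  assumes S: "bounded_op S" and e: "orthonormal_seq e" and a: "Bseq a"
    and basis: "\<And>k. S (e k) = complex_of_real (a k) *\<^sub>C e k"
    and perp: "\<And>y. (\<And>k. cinner (e k) y = 0) \<Longrightarrow> S y = 0"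
  shows "S = diag_op e e a"
proof
  fix x
  interpret S: bounded_linear S using S by (rule bounded_op_linear)
  let ?q = "diag_op e e (\<lambda>_. 1) x"
  have "S (x - ?q) = 0"
    by (rule perp) (simp add: cinner_diff_right cinner_basis_diag_op[OF e e Bseq_one])
  then have "S x = S ?q" by (simp add: S.diff)
  moreover have "(\<lambda>k. S ((complex_of_real 1 * cinner (e k) x) *\<^sub>C e k)) sums S ?q"
    by (rule S.sums[OF diag_op_sums[OF e e Bseq_one]])
  then have "(\<lambda>k. (complex_of_real (a k) * cinner (e k) x) *\<^sub>C e k) sums S ?q"
    by (simp add: bounded_op_scaleC[OF S] basis scaleC_scaleC mult.commute)
  ultimately show "S x = diag_op e e a x" by (simp add: diag_op_def sums_iff)
qed

text \<open>
  Let \<open>S\<close> be any positive square root. On a basis vector with \<open>a k > 0\<close> the equation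
  \<open>(S + a k) (S - a k) (e k) = 0\<close> forces \<open>S (e k) = a k e k\<close>, because \<open>S + a k\<close> is injective. Where
  \<open>S\<^sup>2\<close> vanishes, so does \<open>S\<close>, by \<open>\<parallel>S x\<parallel>\<^sup>2 = \<langle>x, S\<^sup>2 x\<rangle>\<close>; this covers the remaining \<open>e k\<close> and all
  vectors orthogonal to the sequence.
\<close>

lemma sqrt_op_diag_op:
  fixes e :: "nat \<Rightarrow> 'a::chilbert_space"
  assumes e: "orthonormal_seq e" and a: "Bseq a" "\<And>k. a k \<ge> 0"
  shows "sqrt_op (diag_op e e (\<lambda>k. (a k)\<^sup>2)) = diag_op e e a"
  unfolding sqrt_op_def
proof (rule the_equality)
  show "positive_op (diag_op e e a) \<and> diag_op e e a \<circ> diag_op e e a = diag_op e e (\<lambda>k. (a k)\<^sup>2)"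
    by (simp add: positive_op_diag_op[OF e a] fun_eq_iff diag_op_compose[OF e e a(1)] power2_eq_square)
  fix S :: "'a \<Rightarrow> 'a"
  assume "positive_op S \<and> S \<circ> S = diag_op e e (\<lambda>k. (a k)\<^sup>2)"
  then have pos: "positive_op S" and SS: "\<And>x. S (S x) = diag_op e e (\<lambda>k. (a k)\<^sup>2) x"
    by (auto simp: fun_eq_iff)
  have bo: "bounded_op S" using pos by (simp add: positive_op_def)
  interpret S: bounded_linear S using bo by (rule bounded_op_linear)
  note sym = positive_op_symmetric[OF pos]
  have ker: "S x = 0" if "S (S x) = 0" for x
    using sym[of x "S x"] that by (simp add: cinner_self_eq_0)
  show "S = diag_op e e a"
  proof (rule diag_op_eqI[OF bo e a(1)])
    fix k
    have SSe: "S (S (e k)) = ((a k)\<^sup>2) *\<^sub>R e k"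
      by (simp add: SS diag_op_apply_basis[OF e e] scaleR_scaleC)
    show "S (e k) = complex_of_real (a k) *\<^sub>C e k"
    proof (cases "a k = 0")
      case True
      then show ?thesis using SSe ker by simp
    next
      case False
      \<comment> \<open>\<open>w\<close> satisfies \<open>S w = - a k w\<close> with \<open>a k > 0\<close>, while \<open>\<langle>w, S w\<rangle> \<ge> 0\<close>.\<close>
      define w where "w = S (e k) - a k *\<^sub>R e k"
      have "S w + a k *\<^sub>R w = 0"
        by (simp add: w_def S.diff S.scaleR SSe scaleR_diff_right power2_eq_square)
      then have "inner w (S w + a k *\<^sub>R w) = 0" by simp
      then have "Re (cinner w (S w)) + a k * (norm w)\<^sup>2 = 0"
        by (simp add: inner_add_right power2_norm_eq_inner flip: inner_eq_Re_cinner)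
      moreover have "Re (cinner w (S w)) \<ge> 0"
        using pos by (auto simp: positive_op_def complex_nonneg_Reals_iff)
      moreover have "a k > 0" using a(2)[of k] False by simp
      ultimately have "w = 0"
        by (smt (verit) mult_pos_pos zero_less_power zero_less_norm_iff)
      then show ?thesis by (simp add: w_def scaleR_scaleC)
    qed
  next
    fix y assume y: "\<And>k. cinner (e k) y = 0"
    have "S (S y) = 0" unfolding SS by (simp add: diag_op_def y)
    then show "S y = 0" by (rule ker)
  qed
qed

lemma abs_op_diag_op:
  assumes e: "orthonormal_seq e" and f: "orthonormal_seq f" and a: "Bseq a" "\<And>k. a k \<ge> 0"
  shows "abs_op (diag_op e f a) = diag_op f f a"
proof -
  have "adj_op (diag_op e f a) \<circ> diag_op e f a = diag_op f f (\<lambda>k. (a k)\<^sup>2)"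
    by (simp add: adj_op_diag_op[OF e f a(1)] fun_eq_iff diag_op_compose[OF e f a(1)] power2_eq_square)
  then show ?thesis by (simp add: abs_op_def sqrt_op_diag_op[OF f a])
qed

lemma abs_op_compact_diagonal:
  fixes A :: "'a::chilbert_space \<Rightarrow> 'a"
  assumes inf: "infinite_dimensional TYPE('a)" and A: "compact_op A"
  shows "\<exists>e s. orthonormal_seq e \<and> decseq s \<and> (\<forall>k. s k \<ge> 0) \<and> s \<longlonglongrightarrow> 0 \<and> abs_op A = diag_op e e s"
proof -
  have bo: "bounded_op A" using A by (simp add: compact_op_def)
  obtain e a where ea: "orthonormal_seq e" "decseq a" "\<forall>k. a k \<ge> 0" "a \<longlonglongrightarrow> 0"
      "adj_op A \<circ> A = diag_op e e a"
    using compact_positive_op_diagonal[OF inf compact_op_compose[OF bounded_op_adj_op[OF bo] A]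
        positive_op_adj_compose[OF bo]] by blast
  define s where "s k = sqrt (a k)" for k
  have s0: "\<And>k. s k \<ge> 0" using ea(3) by (simp add: s_def)
  have lim: "s \<longlonglongrightarrow> 0" using tendsto_real_sqrt[OF ea(4)] by (simp add: s_def[abs_def])
  have dec: "decseq s" using ea(2) by (simp add: decseq_def s_def)
  have Bs: "Bseq s" using lim convergent_imp_Bseq convergent_def by blast
  have "a = (\<lambda>k. (s k)\<^sup>2)" using ea(3) by (simp add: s_def)
  then have "abs_op A = diag_op e e s"
    unfolding abs_op_def ea(5) using sqrt_op_diag_op[OF ea(1) Bs s0] by simp
  then show ?thesis using ea(1) dec s0 lim by blast
qed

section \<open>Eigenvalue sequences\<close>

lemma finite_level_set:
  fixes l :: "nat \<Rightarrow> 'b::real_normed_vector"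
  assumes "l \<longlonglongrightarrow> 0" "t > 0"
  shows "finite {j. t \<le> norm (l j)}"
proof -
  obtain N where "\<And>n. n \<ge> N \<Longrightarrow> norm (l n) < t" using LIMSEQ_D[OF assms] by auto
  then have "{j. t \<le> norm (l j)} \<subseteq> {..<N}" by (force simp: not_le[symmetric])
  then show ?thesis using finite_subset by blast
qed

lemma finite_fiber:
  fixes l :: "nat \<Rightarrow> 'b::real_normed_vector"
  assumes "l \<longlonglongrightarrow> 0" "z \<noteq> 0"
  shows "finite {j. l j = z}"
  by (rule finite_subset[OF _ finite_level_set[OF assms(1), of "norm z"]]) (use assms(2) in auto)

text \<open>
  For \<open>N = D - z\<close>, the coefficient of \<open>N\<^sup>n x\<close> along \<open>e k\<close> is \<open>(a k - z)\<^sup>n\<close> times that of \<open>x\<close>, and on the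
  orthogonal complement of all \<open>e k\<close> the operator \<open>N\<close> acts as \<open>- z\<close>. So \<open>N\<^sup>n x = 0\<close> leaves only the
  coefficients with \<open>a k = z\<close>.
\<close>

lemma alg_mult_diag_op:
  fixes e :: "nat \<Rightarrow> 'a::chilbert_space"
  assumes e: "orthonormal_seq e" and a: "a \<longlonglongrightarrow> 0" and z: "z \<noteq> 0"
  shows "alg_mult (diag_op e e a) z = card {k. complex_of_real (a k) = z}"
proof -
  have Ba: "Bseq a" using a convergent_imp_Bseq convergent_def by blast
  define K where "K = {k. complex_of_real (a k) = z}"
  have finK: "finite K"
    unfolding K_def using a z by (intro finite_fiber) (auto intro: tendsto_eq_intros)
  define D where "D = diag_op e e a"
  have bo: "bounded_op D" unfolding D_def by (rule bounded_op_diag_op[OF e e Ba])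
  interpret D: bounded_linear D using bo by (rule bounded_op_linear)
  define N where "N y = D y - z *\<^sub>C y" for y
  have "(\<Union>n. {x. (N ^^ n) x = 0}) = complex_vector.span (e ` K)"
  proof (intro equalityI subsetI)
    fix x assume "x \<in> (\<Union>n. {x. (N ^^ n) x = 0})"
    then obtain n where n: "(N ^^ n) x = 0" by blast
    have "cinner (e k) ((N ^^ n) x) = (complex_of_real (a k) - z) ^ n * cinner (e k) x" for k n
      by (induction n) (simp_all add: N_def D_def cinner_diff_right cinner_scaleC_right
          cinner_basis_diag_op[OF e e Ba] algebra_simps)
    from this[of _ n] n have coeff: "k \<in> K \<or> cinner (e k) x = 0" for k
      by (auto simp: K_def)
    define p where "p = (\<Sum>k\<in>K. cinner (e k) x *\<^sub>C e k)"
    define y where "y = x - p"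
    have ey: "cinner (e k) y = 0" for k
      using coeff[of k] by (auto simp: y_def p_def cinner_diff_right cinner_orthonormal_sum[OF e finK])
    then have ye: "cinner y (e k) = 0" for k using cinner_commute[of y "e k"] by simp
    have "cinner y ((N ^^ n) x) = (- z) ^ n * cinner y x" for n
      by (induction n) (simp_all add: N_def D_def cinner_diff_right cinner_scaleC_right
          cinner_diag_op_orthogonal[OF e e Ba ye])
    from this[of n] n z have "cinner y x = 0" by simp
    moreover have "cinner y p = 0" by (simp add: p_def cinner_sum_right cinner_scaleC_right ye)
    ultimately have "cinner y y = 0" by (simp add: y_def cinner_diff_right)
    then have "x = p" by (simp add: cinner_self_eq_0 y_def)
    moreover have "p \<in> complex_vector.span (e ` K)"
      unfolding p_def
      by (intro complex_vector.span_sum complex_vector.span_scale complex_vector.span_base) auto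
    ultimately show "x \<in> complex_vector.span (e ` K)" by simp
  next
    fix x assume "x \<in> complex_vector.span (e ` K)"
    moreover have "e ` K \<subseteq> {x. N x = 0}"
      by (auto simp: N_def D_def K_def diag_op_apply_basis[OF e e])
    moreover have "complex_vector.subspace {x. N x = 0}"
      by (auto simp: complex_vector.subspace_def N_def D.zero D.add bounded_op_scaleC[OF bo]
          scaleC_add_right scaleC_scaleC mult.commute[of z])
    ultimately have "N x = 0" using complex_vector.span_minimal by blast
    then have "(N ^^ 1) x = 0" by simp
    then show "x \<in> (\<Union>n. {x. (N ^^ n) x = 0})" by blast
  qed
  then have "alg_mult D z = complex_vector.dim (complex_vector.span (e ` K))"
    by (simp add: alg_mult_def N_def[abs_def])
  moreover have inj: "inj_on e K"
    using orthonormal_seq_cinner[OF e] by (metis inj_onI zero_neq_one)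
  moreover have "complex_vector.dim (complex_vector.span (e ` K)) = card (e ` K)"
  proof (rule complex_vector.dim_span_eq_card_independent)
    show "complex_vector.independent (e ` K)"
      unfolding complex_vector.dependent_finite[OF finite_imageI[OF finK]]
    proof safe
      fix u k assume k: "k \<in> K" "u (e k) \<noteq> 0" and sum: "(\<Sum>v\<in>e ` K. u v *\<^sub>C v) = 0"
      have "(\<Sum>j\<in>K. u (e j) *\<^sub>C e j) = 0" using sum by (simp add: sum.reindex[OF inj])
      then have "u (e k) = 0"
        using cinner_orthonormal_sum[OF e finK, of k "\<lambda>j. u (e j)"] k(1) by simp
      with k(2) show False by blast
    qed
  qed
  ultimately show ?thesis by (simp add: card_image D_def K_def)
qed

lemma is_eigenvalue_seq_diag_op:
  assumes "orthonormal_seq e" "decseq a" "\<And>k. a k \<ge> 0" "a \<longlonglongrightarrow> 0"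
  shows "is_eigenvalue_seq (diag_op e e a) (\<lambda>k. complex_of_real (a k))"
  unfolding is_eigenvalue_seq_def
proof (intro conjI allI impI)
  show "(\<lambda>k. complex_of_real (a k)) \<longlonglongrightarrow> 0" using tendsto_of_real[OF assms(4)] by simp
  show "decseq (\<lambda>j. cmod (complex_of_real (a j)))" using assms(2,3) by simp
qed (simp add: alg_mult_diag_op[OF assms(1,4)])

text \<open>
  Sequences with the same multiplicities have the same counting function, even if neither is monotone.
  For a decreasing sequence the counting function determines the entries, as \<open>decseq_le_iff_card\<close> shows.
\<close>

lemma card_level_set_cong:
  fixes a b :: "nat \<Rightarrow> real"
  assumes a: "a \<longlonglongrightarrow> 0" and b: "b \<longlonglongrightarrow> 0"
    and eq: "\<And>z. z > 0 \<Longrightarrow> card {k. a k = z} = card {k. b k = z}" and t: "t > 0"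
  shows "card {k. t \<le> a k} = card {k. t \<le> b k}"
proof -
  have fin: "finite {k. t \<le> c k}" if "c \<longlonglongrightarrow> 0" for c :: "nat \<Rightarrow> real"
    by (rule finite_subset[OF _ finite_level_set[OF that t]]) (auto simp: abs_if)
  define V where "V = a ` {k. t \<le> a k} \<union> b ` {k. t \<le> b k}"
  have V: "finite V" "\<And>z. z \<in> V \<Longrightarrow> z \<ge> t" using fin a b by (auto simp: V_def)
  have "card {k. t \<le> c k} = (\<Sum>z\<in>V. card {k. c k = z})"
    if c: "c \<longlonglongrightarrow> 0" "c ` {k. t \<le> c k} \<subseteq> V" for c :: "nat \<Rightarrow> real"
  proof -
    have "{k. t \<le> c k} = (\<Union>z\<in>V. {k. c k = z})" using c(2) V(2) by auto
    moreover have "finite {k. c k = z}" if "z \<in> V" for z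
      using finite_fiber[OF c(1), of z] V(2)[OF that] t by simp
    ultimately show ?thesis using V(1) by (simp add: card_UN_disjoint disjoint_iff)
  qed
  note count = this
  have "card {k. t \<le> a k} = (\<Sum>z\<in>V. card {k. a k = z})"
    by (rule count[OF a]) (simp add: V_def)
  also have "\<dots> = (\<Sum>z\<in>V. card {k. b k = z})"
    using V(2) t by (intro sum.cong refl eq) force
  also have "\<dots> = card {k. t \<le> b k}"
    by (rule count[OF b, symmetric]) (simp add: V_def)
  finally show ?thesis .
qed

lemma decseq_le_iff_card:
  fixes b :: "nat \<Rightarrow> real"
  assumes b: "decseq b" "b \<longlonglongrightarrow> 0" and t: "t > 0"
  shows "t \<le> b j \<longleftrightarrow> j < card {k. t \<le> b k}"
proof
  have fin: "finite {k. t \<le> b k}"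
    by (rule finite_subset[OF _ finite_level_set[OF b(2) t]]) (auto simp: abs_if)
  assume "t \<le> b j"
  then have "{..j} \<subseteq> {k. t \<le> b k}" using b(1) by (force simp: decseq_def)
  then have "card {..j} \<le> card {k. t \<le> b k}" by (intro card_mono fin)
  then show "j < card {k. t \<le> b k}" by simp
next
  assume *: "j < card {k. t \<le> b k}"
  show "t \<le> b j"
  proof (rule ccontr)
    assume "\<not> t \<le> b j"
    then have "{k. t \<le> b k} \<subseteq> {..<j}"
      using b(1) by (auto simp: decseq_def not_le[symmetric]) (meson order_trans)
    then have "card {k. t \<le> b k} \<le> card {..<j}" by (intro card_mono) auto
    with * show False by simp
  qed
qed

lemma decseq_unique_of_fibers:
  fixes a b :: "nat \<Rightarrow> real"
  assumes a: "decseq a" "a \<longlonglongrightarrow> 0" and b: "decseq b" "b \<longlonglongrightarrow> 0"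
    and eq: "\<And>z. z > 0 \<Longrightarrow> card {k. a k = z} = card {k. b k = z}"
  shows "a = b"
proof
  fix j
  have iff: "t \<le> a j \<longleftrightarrow> t \<le> b j" if "t > 0" for t
    using card_level_set_cong[OF a(2) b(2) eq that]
    by (simp only: decseq_le_iff_card[OF a that, of j] decseq_le_iff_card[OF b that, of j])
  have "a j \<ge> 0" "b j \<ge> 0" by (rule decseq_ge[OF a] decseq_ge[OF b])+
  moreover have "a j \<le> b j" if "a j > 0" using iff[OF that] by simp
  moreover have "b j \<le> a j" if "b j > 0" using iff[OF that] by simp
  ultimately show "a j = b j" by argo
qed

text \<open>
  Every nonzero entry of \<open>l\<close> has positive multiplicity, hence is some \<open>b k\<close>. So \<open>l\<close> is nonnegative,
  and two decreasing null sequences with the same multiplicities agree.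
\<close>

lemma is_eigenvalue_seq_diag_op_unique:
  assumes e: "orthonormal_seq e" and b: "decseq b" "\<And>k. b k \<ge> 0" "b \<longlonglongrightarrow> 0"
    and l: "is_eigenvalue_seq (diag_op e e b) l"
  shows "l = (\<lambda>k. complex_of_real (b k))"
proof -
  have l0: "l \<longlonglongrightarrow> 0" and dec: "decseq (\<lambda>j. cmod (l j))"
    and card: "\<And>z. z \<noteq> 0 \<Longrightarrow> card {j. l j = z} = card {k. complex_of_real (b k) = z}"
    using l by (auto simp: is_eigenvalue_seq_def alg_mult_diag_op[OF e b(3)])
  have lc: "l j = complex_of_real (cmod (l j))" for j
  proof (cases "l j = 0")
    case False
    have "j \<in> {i. l i = l j}" by simp
    then have "card {i. l i = l j} \<noteq> 0"
      using finite_fiber[OF l0 False] by (metis card_0_eq empty_iff)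
    then have "{k. complex_of_real (b k) = l j} \<noteq> {}"
      using card[OF False] by (metis card.empty)
    then obtain k where "complex_of_real (b k) = l j" by auto
    from this[symmetric] show ?thesis using b(2)[of k] by simp
  qed simp
  have "(\<lambda>j. cmod (l j)) = b"
  proof (rule decseq_unique_of_fibers[OF dec _ b(1,3)])
    show "(\<lambda>j. cmod (l j)) \<longlonglongrightarrow> 0" using l0 by (rule tendsto_norm_zero)
    fix z :: real assume "z > 0"
    moreover have "cmod (l j) = z \<longleftrightarrow> l j = complex_of_real z" for j
      using lc[of j] \<open>z > 0\<close> by (metis norm_of_real abs_of_pos)
    ultimately show "card {j. cmod (l j) = z} = card {k. b k = z}"
      using card[of "complex_of_real z"] by simp
  qed
  then show ?thesis using lc by (auto simp: fun_eq_iff)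
qed

lemma eigenvalue_seq_diag_op:
  assumes "orthonormal_seq e" "decseq b" "\<And>k. b k \<ge> 0" "b \<longlonglongrightarrow> 0"
  shows "eigenvalue_seq (diag_op e e b) = (\<lambda>k. complex_of_real (b k))"
proof (rule is_eigenvalue_seq_diag_op_unique[OF assms])
  show "is_eigenvalue_seq (diag_op e e b) (eigenvalue_seq (diag_op e e b))"
    unfolding eigenvalue_seq_def
    using someI[of "is_eigenvalue_seq (diag_op e e b)", OF is_eigenvalue_seq_diag_op[OF assms]] .
qed

section \<open>Diagonal operators in the weak trace class\<close>

text \<open>
  The nonnegative sequences that serve as entries of operators in \<^const>\<open>weak_trace_class\<close>. They form
  a convex cone containing with each sequence all smaller nonnegative ones. Monotone sequences would
  not do: differences such as \<open>b - a\<close> for \<open>a \<le> b\<close> are needed to exploit positivity of a trace.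
\<close>

definition harmonic_bounded :: "(nat \<Rightarrow> real) \<Rightarrow> bool" where
  "harmonic_bounded a \<longleftrightarrow> (\<exists>C. \<forall>k. 0 \<le> a k \<and> a k \<le> C / (real k + 1))"

lemma harmonic_bounded_nonneg: "harmonic_bounded a \<Longrightarrow> 0 \<le> a k"
  by (auto simp: harmonic_bounded_def)

lemma harmonic_bounded_imp_Bseq:
  assumes "harmonic_bounded a" shows "Bseq a"
proof -
  obtain C where C: "\<And>k. 0 \<le> a k" "\<And>k. a k \<le> C / (real k + 1)"
    using assms by (auto simp: harmonic_bounded_def)
  have "C \<ge> 0" using C[of 0] by simp
  have "\<bar>a k\<bar> \<le> C" for k
  proof -
    have "C / (real k + 1) \<le> C / 1" using \<open>C \<ge> 0\<close> by (intro divide_left_mono) auto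
    then show ?thesis using C[of k] by simp
  qed
  then show ?thesis by (rule Bseq_real_intro)
qed

lemma harmonic_bounded_mono:
  assumes "harmonic_bounded b" "\<And>k. 0 \<le> a k" "\<And>k. a k \<le> b k"
  shows "harmonic_bounded a"
  using assms unfolding harmonic_bounded_def by (meson order_trans)

lemma harmonic_bounded_add:
  assumes "harmonic_bounded a" "harmonic_bounded b"
  shows "harmonic_bounded (\<lambda>k. a k + b k)"
proof -
  obtain C D where "\<forall>k. 0 \<le> a k \<and> a k \<le> C / (real k + 1)" "\<forall>k. 0 \<le> b k \<and> b k \<le> D / (real k + 1)"
    using assms unfolding harmonic_bounded_def by blast
  then have "\<forall>k. 0 \<le> a k + b k \<and> a k + b k \<le> (C + D) / (real k + 1)"
    by (auto simp: add_divide_distrib intro: add_mono)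
  then show ?thesis unfolding harmonic_bounded_def by blast
qed

lemma harmonic_bounded_scale:
  assumes "harmonic_bounded a" "r \<ge> 0"
  shows "harmonic_bounded (\<lambda>k. r * a k)"
proof -
  obtain C where C: "\<forall>k. 0 \<le> a k \<and> a k \<le> C / (real k + 1)"
    using assms(1) unfolding harmonic_bounded_def by blast
  have "r * a k \<le> r * C / (real k + 1)" for k
    using mult_left_mono[OF conjunct2[OF spec[OF C, of k]] assms(2)] by simp
  then have "\<forall>k. 0 \<le> r * a k \<and> r * a k \<le> (r * C) / (real k + 1)" using C assms(2) by simp
  then show ?thesis unfolding harmonic_bounded_def by blast
qed

lemma harmonic_bounded_harmonic: "harmonic_bounded (\<lambda>k. 1 / (real k + 1))"
  unfolding harmonic_bounded_def by (rule exI[of _ 1]) simp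

lemma harmonic_bounded_single: "harmonic_bounded (\<lambda>k. if k = i then 1 else 0)"
  unfolding harmonic_bounded_def by (rule exI[of _ "real i + 1"]) auto

lemma harmonic_bounded_finite:
  assumes "\<And>k. 0 \<le> r k"
  shows "harmonic_bounded (\<lambda>k. if k < N then r k else 0)"
proof (induction N)
  case 0
  show ?case unfolding harmonic_bounded_def by (intro exI[of _ 0]) simp
next
  case (Suc N)
  have "(\<lambda>k. if k < Suc N then r k else 0)
      = (\<lambda>k. (if k < N then r k else 0) + r N * (if k = N then 1 else 0))" by (auto simp: less_Suc_eq)
  then show ?case
    using harmonic_bounded_add[OF Suc harmonic_bounded_scale[OF harmonic_bounded_single assms]] by simp
qed

text \<open>
  The singular values form the decreasing rearrangement \<open>b\<close> of \<open>a\<close>, which the spectral theorem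
  supplies. If \<open>t = b j > 0\<close>, then more than \<open>j\<close> entries of \<open>a\<close> are at least \<open>t\<close>, while
  \<open>a k \<le> C / (k + 1)\<close> allows at most \<open>C / t\<close> of them; hence \<open>b j \<le> C / (j + 1)\<close>.
\<close>

lemma diag_op_weak_trace_class:
  fixes e f :: "nat \<Rightarrow> 'a::chilbert_space"
  assumes inf: "infinite_dimensional TYPE('a)"
    and e: "orthonormal_seq e" and f: "orthonormal_seq f"
    and "harmonic_bounded a"
  shows "diag_op e f a \<in> weak_trace_class"
proof -
  obtain C where a: "\<And>k. 0 \<le> a k" "\<And>k. a k \<le> C / (real k + 1)"
    using assms(4) by (auto simp: harmonic_bounded_def)
  have "(\<lambda>k. C / (real k + 1)) \<longlonglongrightarrow> 0"
    using LIMSEQ_Suc[OF lim_const_over_n[of C]] by (simp add: add.commute)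
  then have lim: "a \<longlonglongrightarrow> 0"
    by (rule Lim_null_comparison[rotated]) (use a in simp)
  then have B: "Bseq a" using convergent_imp_Bseq convergent_def by blast
  obtain g b where g: "orthonormal_seq g" and b: "decseq b" "\<And>k. b k \<ge> 0" "b \<longlonglongrightarrow> 0"
      and eq: "diag_op f f a = diag_op g g b"
    using compact_positive_op_diagonal[OF inf compact_op_diag_op[OF f f lim] positive_op_diag_op[OF f B a(1)]]
    by blast
  have sv: "singular_value (diag_op e f a) = b"
    by (simp add: singular_value_def[abs_def] abs_op_diag_op[OF e f B a(1)] eq
        eigenvalue_seq_diag_op[OF g b])
  have fibers: "card {k. b k = z} = card {k. a k = z}" if "z > 0" for z
    using alg_mult_diag_op[OF g b(3), of "complex_of_real z"] that
      alg_mult_diag_op[OF f lim, of "complex_of_real z"] by (simp add: eq)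
  have "b j \<le> C / (real j + 1)" for j
  proof (cases "b j = 0")
    case True
    then show ?thesis using a[of j] by linarith
  next
    case False
    define t where "t = b j"
    have t: "t > 0" using False b(2)[of j] by (simp add: t_def)
    have "j < card {k. t \<le> b k}" using decseq_le_iff_card[OF b(1,3) t, of j] by (simp add: t_def)
    also have "\<dots> = card {k. t \<le> a k}" by (rule card_level_set_cong[OF b(3) lim fibers t])
    also have "\<dots> \<le> card {..<nat \<lfloor>C / t\<rfloor>}"
    proof (intro card_mono subsetI)
      fix k assume "k \<in> {k. t \<le> a k}"
      then have "t \<le> C / (real k + 1)" using a(2)[of k] by simp
      then have "real k + 1 \<le> C / t" using t by (simp add: field_simps)
      then show "k \<in> {..<nat \<lfloor>C / t\<rfloor>}" by simp linarith
    qed simp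
    finally have "real j + 1 \<le> C / t" by simp linarith
    then show ?thesis using t by (simp add: field_simps t_def)
  qed
  then have "b \<in> O(\<lambda>j. 1 / real j)"
  proof (intro bigoI[of _ "\<bar>C\<bar>"] eventually_mono[OF eventually_gt_at_top[of 0]])
    fix j :: nat assume "j > 0" "\<And>j. b j \<le> C / (real j + 1)"
    then have "b j \<le> C / (real j + 1)" by blast
    also have "\<dots> \<le> \<bar>C\<bar> / real j" using \<open>j > 0\<close> by (intro frac_le) auto
    finally show "norm (b j) \<le> \<bar>C\<bar> * norm (1 / real j)" using b(2)[of j] by simp
  qed
  then show ?thesis by (simp add: weak_trace_class_def compact_op_diag_op[OF e f lim] sv)
qed

section \<open>Positive traces on diagonal operators\<close>

lemma diag_op_minus_left:
  assumes "orthonormal_seq e" "orthonormal_seq f" "Bseq a"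
  shows "diag_op (\<lambda>k. - e k) f a x = - diag_op e f a x"
proof -
  have "(\<lambda>k. (complex_of_real (a k) * cinner (f k) x) *\<^sub>C (- e k)) sums (- diag_op e f a x)"
    using sums_minus[OF diag_op_sums[OF assms, of x]] by (simp add: complex_vector.scale_minus_right)
  then show ?thesis by (simp add: diag_op_def sums_iff)
qed

lemma orthonormal_seq_minus: "orthonormal_seq e \<Longrightarrow> orthonormal_seq (\<lambda>k. - e k)"
  by (simp add: orthonormal_seq_def cinner_minus_left cinner_minus_right)

text \<open>
  With the partial isometry \<open>U\<close> taking \<open>e k\<close> to \<open>f k\<close> and \<open>T = diag_op e f a\<close>, the two operators are
  \<open>T U\<close> and \<open>U T\<close>. Additivity is only available inside the ideal; the operator \<open>- T U\<close> is in it
  because it is diagonal with respect to the sequences \<open>- e\<close> and \<open>e\<close>.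
\<close>

lemma trace_diag_op_basis_change:
  fixes \<phi> :: "('a::chilbert_space \<Rightarrow> 'a) \<Rightarrow> complex"
  assumes inf: "infinite_dimensional TYPE('a)" and \<phi>: "is_trace \<phi>"
    and e: "orthonormal_seq e" and f: "orthonormal_seq f" and a: "harmonic_bounded a"
  shows "\<phi> (diag_op e e a) = \<phi> (diag_op f f a)"
proof -
  note B = harmonic_bounded_imp_Bseq[OF a]
  note wtc = diag_op_weak_trace_class[OF inf _ _ a]
  let ?M = "diag_op (\<lambda>k. - e k) e a"
  have M: "?M \<in> weak_trace_class" by (rule wtc[OF orthonormal_seq_minus[OF e] e])
  have add: "\<phi> (\<lambda>x. S x + T x) = \<phi> S + \<phi> T" if "S \<in> weak_trace_class" "T \<in> weak_trace_class" for S T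
    using \<phi> that by (simp add: is_trace_def)
  have "\<phi> (\<lambda>x. diag_op f e (\<lambda>_. 1) (diag_op e f a x) - diag_op e f a (diag_op f e (\<lambda>_. 1) x)) = 0"
    using \<phi> bounded_op_diag_op[OF f e Bseq_one] wtc[OF e f] by (simp add: is_trace_def)
  then have "\<phi> (\<lambda>x. diag_op f f a x + ?M x) = 0"
    by (simp add: diag_op_compose[OF e f B] diag_op_compose[OF f e Bseq_one] diag_op_minus_left[OF e e B])
  then have "\<phi> (diag_op f f a) + \<phi> ?M = 0" by (simp add: add[OF wtc[OF f f] M])
  moreover have "\<phi> (\<lambda>x. 0 *\<^sub>C ?M x) = 0 * \<phi> ?M" using \<phi> M unfolding is_trace_def by blast
  then have "\<phi> (\<lambda>x. diag_op e e a x + ?M x) = 0" by (simp add: diag_op_minus_left[OF e e B])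
  then have "\<phi> (diag_op e e a) + \<phi> ?M = 0" by (simp add: add[OF wtc[OF e e] M])
  ultimately show ?thesis by (metis add_right_cancel)
qed

text \<open>
  On harmonically bounded sequences, \<open>a \<mapsto> \<phi> (diag_op f f a)\<close> is additive, homogeneous and monotone, and
  it equals \<open>1\<close> at \<open>h k = 1 / (k + 1)\<close> by normalization and invariance. It takes the same value \<open>c\<close> at
  all rank one projections, and since \<open>h\<close> dominates its truncations, \<open>c\<close> times every harmonic number
  is at most \<open>1\<close>; thus \<open>c = 0\<close>, and finitely many entries never matter. Up to finitely many entries,
  \<open>a\<close> lies between \<open>(L - \<epsilon>) h\<close> and \<open>(L + \<epsilon>) h\<close>.
\<close>

lemma positive_normalized_trace_diag_op:
  fixes \<phi> :: "('a::chilbert_space \<Rightarrow> 'a) \<Rightarrow> complex"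
  assumes inf: "infinite_dimensional TYPE('a)"
    and pos: "positive_trace \<phi>" and norm: "normalized_trace \<phi>"
    and f: "orthonormal_seq f" and a0: "\<And>k. a k \<ge> 0"
    and lim: "(\<lambda>k. (real k + 1) * a k) \<longlonglongrightarrow> L"
  shows "\<phi> (diag_op f f a) = complex_of_real L"
proof -
  have tr: "is_trace \<phi>" using pos by (simp add: positive_trace_def)
  define h where "h k = 1 / (real k + 1)" for k :: nat
  have hb_h: "harmonic_bounded h" unfolding h_def[abs_def] by (rule harmonic_bounded_harmonic)
  have h0: "h k \<ge> 0" for k by (simp add: h_def)
  define g where "g b = Re (\<phi> (diag_op f f b))" for b
  note wtc = diag_op_weak_trace_class[OF inf f f]
  have g_nonneg: "g b \<ge> 0" and \<phi>_g: "\<phi> (diag_op f f b) = complex_of_real (g b)"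
    if b: "harmonic_bounded b" for b
  proof -
    have "positive_op (diag_op f f b)"
      using positive_op_diag_op[OF f harmonic_bounded_imp_Bseq[OF b]] b harmonic_bounded_nonneg by blast
    then have "\<phi> (diag_op f f b) \<in> \<real>\<^sub>\<ge>\<^sub>0"
      using pos wtc[OF b] by (simp add: positive_trace_def)
    then show "g b \<ge> 0" "\<phi> (diag_op f f b) = complex_of_real (g b)"
      by (auto simp: g_def complex_nonneg_Reals_iff complex_eq_iff)
  qed
  have g_add: "g (\<lambda>k. b k + c k) = g b + g c" if "harmonic_bounded b" "harmonic_bounded c" for b c
  proof -
    have "diag_op f f (\<lambda>k. b k + c k) = (\<lambda>x. diag_op f f b x + diag_op f f c x)"
      using diag_op_add[OF f f] that harmonic_bounded_imp_Bseq by blast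
    then show ?thesis using tr wtc[OF that(1)] wtc[OF that(2)] by (simp add: g_def is_trace_def)
  qed
  have g_scale: "g (\<lambda>k. r * b k) = r * g b" if "harmonic_bounded b" for r b
  proof -
    have "diag_op f f (\<lambda>k. r * b k) = (\<lambda>x. complex_of_real r *\<^sub>C diag_op f f b x)"
      using diag_op_scale[OF f f] that harmonic_bounded_imp_Bseq by blast
    then show ?thesis using tr wtc[OF that] by (simp add: g_def is_trace_def)
  qed
  have g_mono: "g b \<le> g c" if "harmonic_bounded b" "harmonic_bounded c" "\<And>k. b k \<le> c k" for b c
  proof -
    have "harmonic_bounded (\<lambda>k. c k - b k)"
      by (rule harmonic_bounded_mono[OF that(2)]) (use that(3) harmonic_bounded_nonneg[OF that(1)] in auto)
    then show ?thesis using g_add[OF that(1), of "\<lambda>k. c k - b k"] g_nonneg by fastforce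
  qed
  have g_h: "g h = 1"
  proof -
    obtain T where T: "T \<in> weak_trace_class" "positive_op T" "\<phi> T = 1"
        "is_eigenvalue_seq T (\<lambda>j. complex_of_real (1 / (real j + 1)))"
      using norm by (auto simp: normalized_trace_def)
    then obtain e b where eb: "orthonormal_seq e" "decseq b" "\<And>k. b k \<ge> 0" "b \<longlonglongrightarrow> 0" "T = diag_op e e b"
      using compact_positive_op_diagonal[OF inf, of T] by (auto simp: weak_trace_class_def)
    have "(\<lambda>j. complex_of_real (1 / (real j + 1))) = (\<lambda>k. complex_of_real (b k))"
      by (rule is_eigenvalue_seq_diag_op_unique[OF eb(1-4)]) (use T(4) eb(5) in simp)
    then have "b = h" unfolding h_def[abs_def] by (metis (no_types, opaque_lifting) of_real_eq_iff)
    then have "\<phi> (diag_op e e h) = 1" using T(3) eb(5) by simp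
    then show ?thesis
      using trace_diag_op_basis_change[OF inf tr eb(1) f hb_h] by (simp add: g_def)
  qed
  define \<delta> where "\<delta> i k = (if k = i then 1 else 0 :: real)" for i k :: nat
  have hb_\<delta>: "harmonic_bounded (\<delta> i)" for i
    unfolding \<delta>_def[abs_def] by (rule harmonic_bounded_single)
  have rank_one: "diag_op u u (\<delta> i) x = cinner (u i) x *\<^sub>C u i" for u :: "nat \<Rightarrow> 'a" and i x
  proof -
    have "(\<lambda>k. (complex_of_real (\<delta> i k) * cinner (u k) x) *\<^sub>C u k)
        = (\<lambda>k. if k = i then cinner (u k) x *\<^sub>C u k else 0)" by (auto simp: \<delta>_def)
    then show ?thesis
      using sums_single[of i "\<lambda>k. cinner (u k) x *\<^sub>C u k"] by (simp add: diag_op_def sums_iff)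
  qed
  define c where "c = g (\<delta> 0)"
  have g_\<delta>: "g (\<delta> i) = c" for i
  proof -
    \<comment> \<open>Shifting the orthonormal sequence moves the projection onto \<open>f i\<close> to index \<open>0\<close>.\<close>
    define f' where "f' k = f (k + i)" for k
    have f': "orthonormal_seq f'" using f by (simp add: orthonormal_seq_def f'_def)
    have "diag_op f f (\<delta> i) = diag_op f' f' (\<delta> 0)" by (simp add: fun_eq_iff rank_one f'_def)
    then show ?thesis
      using trace_diag_op_basis_change[OF inf tr f' f hb_\<delta>[of 0]] by (simp add: g_def c_def)
  qed
  have g_finite: "g (\<lambda>k. if k < N then r k else 0) = c * (\<Sum>k<N. r k)" if r: "\<And>k. r k \<ge> 0" for r N
  proof (induction N)
    case 0
    then show ?case using g_scale[OF hb_h, of 0] by simp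
  next
    case (Suc N)
    have "(\<lambda>k. if k < Suc N then r k else 0) = (\<lambda>k. (if k < N then r k else 0) + r N * \<delta> N k)"
      by (auto simp: less_Suc_eq \<delta>_def)
    then have "g (\<lambda>k. if k < Suc N then r k else 0)
        = g (\<lambda>k. if k < N then r k else 0) + r N * g (\<delta> N)"
      using g_add[OF harmonic_bounded_finite[of r N, OF r] harmonic_bounded_scale[OF hb_\<delta> r]]
        g_scale[OF hb_\<delta>] by simp
    then show ?case by (simp add: Suc g_\<delta> distrib_left mult.commute)
  qed
  \<comment> \<open>The harmonic series diverges, so rank one operators have trace \<open>0\<close>.\<close>
  have "c = 0"
  proof (rule ccontr)
    assume "c \<noteq> 0"
    then have "c > 0" using g_nonneg[OF hb_\<delta>[of 0]] by (simp add: c_def)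
    have "(\<Sum>k<N. h k) \<le> 1 / c" for N
    proof -
      have "c * (\<Sum>k<N. h k) \<le> g h"
        unfolding g_finite[OF h0, symmetric]
        by (rule g_mono[OF harmonic_bounded_finite[OF h0] hb_h]) (simp add: h0)
      then show ?thesis using \<open>c > 0\<close> by (simp add: g_h field_simps)
    qed
    then have "summable h" by (intro summableI_nonneg_bounded h0)
    then have "summable (\<lambda>k. inverse (of_nat (Suc k)) :: real)"
      by (simp add: h_def[abs_def] inverse_eq_divide add.commute)
    then show False using not_summable_harmonic[where 'a = real]
      by (simp only: summable_Suc_iff[of "\<lambda>n. inverse (of_nat n)"])
  qed
  then have g_finite0: "g (\<lambda>k. if k < N then r k else 0) = 0" if "\<And>k. r k \<ge> 0" for r N
    using g_finite[OF that] by simp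
  have "Bseq (\<lambda>k. (real k + 1) * a k)" using lim convergent_imp_Bseq convergent_def by blast
  then obtain C where C: "\<And>k. \<bar>(real k + 1) * a k\<bar> \<le> C" by (rule Bseq_real_bound) blast
  have hb_a: "harmonic_bounded a"
    unfolding harmonic_bounded_def
  proof (intro exI[of _ C] allI conjI a0)
    fix k show "a k \<le> C / (real k + 1)" using C[of k] a0[of k] by (simp add: field_simps)
  qed
  have "L \<ge> 0" by (rule LIMSEQ_le_const[OF lim]) (simp add: a0)
  have approx: "g a \<le> L + \<epsilon> \<and> L \<le> g a + \<epsilon>" if "\<epsilon> > 0" for \<epsilon>
  proof -
    obtain N where N: "\<And>k. k \<ge> N \<Longrightarrow> \<bar>(real k + 1) * a k - L\<bar> < \<epsilon>"
      using LIMSEQ_D[OF lim \<open>\<epsilon> > 0\<close>] by auto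
    have a_h: "a k = ((real k + 1) * a k) * h k" for k by (simp add: h_def)
    have up: "a k \<le> (L + \<epsilon>) * h k" and lo: "L * h k \<le> a k + \<epsilon> * h k" if "k \<ge> N" for k
    proof -
      have "((real k + 1) * a k) * h k \<le> (L + \<epsilon>) * h k" "L * h k \<le> ((real k + 1) * a k + \<epsilon>) * h k"
        using N[OF that] by (intro mult_right_mono h0; simp add: abs_less_iff)+
      then show "a k \<le> (L + \<epsilon>) * h k" "L * h k \<le> a k + \<epsilon> * h k"
        unfolding distrib_right[of "(real k + 1) * a k"] a_h[symmetric] by auto
    qed
    let ?cut = "\<lambda>r k. if k < N then r k else 0 :: real"
    have hb1: "harmonic_bounded (\<lambda>k. (L + \<epsilon>) * h k)"
      and hb2: "harmonic_bounded (\<lambda>k. L * h k)" and hb3: "harmonic_bounded (\<lambda>k. \<epsilon> * h k)"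
      using \<open>L \<ge> 0\<close> \<open>\<epsilon> > 0\<close> by (auto intro!: harmonic_bounded_scale hb_h)
    have "g a \<le> g (\<lambda>k. (L + \<epsilon>) * h k + ?cut a k)"
    proof (rule g_mono[OF hb_a harmonic_bounded_add[OF hb1 harmonic_bounded_finite[of a, OF a0]]])
      fix k
      have "0 \<le> (L + \<epsilon>) * h k" using hb1 by (rule harmonic_bounded_nonneg)
      then show "a k \<le> (L + \<epsilon>) * h k + ?cut a k" using up[of k] by simp
    qed
    also have "\<dots> = L + \<epsilon>"
      by (simp add: g_add[OF hb1 harmonic_bounded_finite[of a, OF a0]] g_scale[OF hb_h] g_h g_finite0[of a, OF a0])
    finally have 1: "g a \<le> L + \<epsilon>" .
    have L0: "L * h k \<ge> 0" for k using \<open>L \<ge> 0\<close> h0 by simp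
    have "g (\<lambda>k. L * h k) \<le> g (\<lambda>k. (a k + \<epsilon> * h k) + ?cut (\<lambda>k. L * h k) k)"
    proof (rule g_mono[OF hb2 harmonic_bounded_add[OF harmonic_bounded_add[OF hb_a hb3]
            harmonic_bounded_finite[of "\<lambda>k. L * h k", OF L0]]])
      fix k
      have "0 \<le> \<epsilon> * h k" using hb3 by (rule harmonic_bounded_nonneg)
      then show "L * h k \<le> (a k + \<epsilon> * h k) + ?cut (\<lambda>k. L * h k) k" using lo[of k] a0[of k] by simp
    qed
    also have "\<dots> = g a + \<epsilon>"
      by (simp add: g_add[OF harmonic_bounded_add[OF hb_a hb3] harmonic_bounded_finite[of "\<lambda>k. L * h k", OF L0]]
          g_add[OF hb_a hb3] g_scale[OF hb_h] g_h g_finite0[of "\<lambda>k. L * h k", OF L0])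
    finally have "L \<le> g a + \<epsilon>" by (simp add: g_scale[OF hb_h] g_h)
    with 1 show ?thesis by simp
  qed
  have "g a \<le> L" by (rule field_le_epsilon) (use approx in blast)
  moreover have "L \<le> g a" by (rule field_le_epsilon) (use approx in blast)
  ultimately show ?thesis using \<phi>_g[OF hb_a] by simp
qed

section \<open>Extended limits and logarithmic means\<close>

text \<open>
  Evaluation at \<open>n\<close> satisfies all the requirements but the last one, which holds in the limit
  \<open>n \<rightarrow> \<infinity>\<close>. By Tychonoff's theorem the evaluations have a cluster point in the product topology, and
  all the requirements pass to it. Unbounded sequences are sent to \<open>0\<close> to stay in a compact product.
\<close>

lemma extended_limit_exists: "\<exists>\<omega>. extended_limit \<omega>"
proof -
  define X :: "nat \<Rightarrow> (nat \<Rightarrow> complex) \<Rightarrow> complex" where "X n a = (if Bseq a then a n else 0)" for n a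
  have "\<exists>r. \<forall>n. cmod (X n a) \<le> r" for a
  proof (cases "Bseq a")
    case True
    then obtain K where "\<forall>n. cmod (a n) \<le> K" unfolding Bseq_def by blast
    then show ?thesis by (auto simp: X_def True)
  qed (auto simp: X_def intro!: exI[of _ 0])
  then obtain r where r: "\<And>n a. cmod (X n a) \<le> r a" by metis
  let ?K = "PiE UNIV (\<lambda>a. cball (0 :: complex) (r a))"
  have "compactin (product_topology (\<lambda>_. euclidean) UNIV) ?K"
    by (simp add: compactin_PiE)
  then have K: "compact ?K" by (simp add: euclidean_product_topology)
  let ?F = "filtermap X sequentially"
  have "eventually (\<lambda>x. x \<in> ?K) ?F" using r by (simp add: eventually_filtermap PiE_def)
  moreover have "?F \<noteq> bot" by (simp add: filtermap_bot_iff)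
  ultimately obtain \<omega> where \<omega>: "inf (nhds \<omega>) ?F \<noteq> bot" using K unfolding compact_filter by blast
  define G where "G = inf (nhds \<omega>) ?F"
  have G: "G \<noteq> bot" "G \<le> nhds \<omega>" "G \<le> ?F" using \<omega> by (auto simp: G_def)
  have lim: "((\<lambda>x. x a) \<longlongrightarrow> \<omega> a) G" for a
  proof -
    have "continuous_on UNIV (\<lambda>x :: (nat \<Rightarrow> complex) \<Rightarrow> complex. x a)"
      by (rule continuous_on_product_coordinates)
    then have "((\<lambda>x. x a) \<longlongrightarrow> \<omega> a) (at \<omega>)" by (simp add: continuous_on_def)
    then have "((\<lambda>x. x a) \<longlongrightarrow> \<omega> a) (nhds \<omega>)" by (rule iffD1[OF tendsto_at_iff_tendsto_nhds[of "\<lambda>x. x a" \<omega>]])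
    then show ?thesis using G(2) filterlim_mono order_refl by blast
  qed
  have ev: "eventually P G" if "\<And>n. P (X n)" for P
    using G(3) that by (auto simp: le_filter_def eventually_filtermap)
  show ?thesis
    unfolding extended_limit_def
  proof (intro exI[of _ \<omega>] conjI allI impI)
    fix a b :: "nat \<Rightarrow> complex" assume B: "Bseq a" "Bseq b"
    obtain K L where KL: "\<And>n. cmod (a n) \<le> K" "\<And>n. cmod (b n) \<le> L"
      using B unfolding Bseq_def by blast
    have "Bseq (\<lambda>n. a n + b n)"
      by (rule BseqI'[of _ "K + L"]) (meson KL add_mono norm_triangle_le)
    then have "eventually (\<lambda>x. x a + x b = x (\<lambda>n. a n + b n)) G"
      using B by (intro ev) (simp add: X_def)
    then have "((\<lambda>x. x (\<lambda>n. a n + b n)) \<longlongrightarrow> \<omega> a + \<omega> b) G"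
      by (rule Lim_transform_eventually[OF tendsto_add[OF lim lim]])
    then show "\<omega> (\<lambda>n. a n + b n) = \<omega> a + \<omega> b" using tendsto_unique[OF G(1) lim] by blast
  next
    fix c and a :: "nat \<Rightarrow> complex" assume B: "Bseq a"
    have "Bseq (\<lambda>n. c * a n)" using B Bseq_mult[of "\<lambda>_. c" a] by simp
    then have "eventually (\<lambda>x. c * x a = x (\<lambda>n. c * a n)) G"
      using B by (intro ev) (simp add: X_def)
    then have "((\<lambda>x. x (\<lambda>n. c * a n)) \<longlongrightarrow> c * \<omega> a) G"
      by (rule Lim_transform_eventually[OF tendsto_mult_left[OF lim]])
    then show "\<omega> (\<lambda>n. c * a n) = c * \<omega> a" using tendsto_unique[OF G(1) lim] by blast
  next
    fix a :: "nat \<Rightarrow> complex" assume "Bseq a" "\<forall>n. a n \<in> \<real>\<^sub>\<ge>\<^sub>0"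
    then have "eventually (\<lambda>x. x a \<in> \<real>\<^sub>\<ge>\<^sub>0) G" by (intro ev) (simp add: X_def)
    then show "\<omega> a \<in> \<real>\<^sub>\<ge>\<^sub>0" by (intro Lim_in_closed_set[OF closed_nonneg_Reals_complex _ G(1) lim])
  next
    have "eventually (\<lambda>x. 1 = x (\<lambda>n. 1)) G" by (intro ev) (simp add: X_def)
    then have "((\<lambda>x. x (\<lambda>n. 1)) \<longlongrightarrow> 1) G" by (rule Lim_transform_eventually[OF tendsto_const])
    then show "\<omega> (\<lambda>n. 1) = 1" using tendsto_unique[OF G(1) lim] by blast
  next
    fix a :: "nat \<Rightarrow> complex" assume a: "a \<longlonglongrightarrow> 0"
    then have "Bseq a" using convergent_imp_Bseq convergent_def by blast
    then have "((\<lambda>x. x a) \<longlongrightarrow> 0) ?F" using a by (simp add: filterlim_filtermap X_def)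
    then have "((\<lambda>x. x a) \<longlongrightarrow> 0) G" using G(3) filterlim_mono order_refl by blast
    then show "\<omega> a = 0" using tendsto_unique[OF G(1) lim] by blast
  qed
qed

lemma extended_limit_convergent:
  assumes \<omega>: "extended_limit \<omega>" and a: "a \<longlonglongrightarrow> L"
  shows "\<omega> a = L"
proof -
  have d: "(\<lambda>n. a n - L) \<longlonglongrightarrow> 0" using a by (simp add: LIM_zero)
  then have B: "Bseq (\<lambda>n. a n - L)" using convergent_imp_Bseq convergent_def by blast
  have 1: "Bseq (\<lambda>n. L * 1)" "Bseq (\<lambda>n. 1 :: complex)" by simp_all
  have "\<omega> (\<lambda>n. (a n - L) + L * 1) = \<omega> (\<lambda>n. a n - L) + \<omega> (\<lambda>n. L * 1)"
    using \<omega> B 1(1) unfolding extended_limit_def by blast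
  also have "\<omega> (\<lambda>n. a n - L) = 0" using \<omega> d unfolding extended_limit_def by blast
  also have "\<omega> (\<lambda>n. L * 1) = L * \<omega> (\<lambda>n. 1)" using \<omega> 1(2) unfolding extended_limit_def by blast
  also have "\<omega> (\<lambda>n. 1) = 1" using \<omega> unfolding extended_limit_def by blast
  finally show ?thesis by simp
qed

lemma filterlim_ln_Suc: "filterlim (\<lambda>n. ln (real (Suc n))) at_top sequentially"
  by (rule filterlim_compose[OF ln_at_top])
    (rule filterlim_compose[OF filterlim_real_sequentially filterlim_Suc])

lemma harm_div_ln: "(\<lambda>n. harm (Suc n) / ln (real (Suc n))) \<longlonglongrightarrow> (1 :: real)"
proof -
  have "(\<lambda>n. (harm (Suc n) - ln (real (Suc n))) / ln (real (Suc n))) \<longlonglongrightarrow> (0 :: real)"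
    by (rule tendsto_divide_0[OF LIMSEQ_Suc[OF euler_mascheroni_LIMSEQ]])
      (rule filterlim_at_top_imp_at_infinity[OF filterlim_ln_Suc])
  from tendsto_add[OF this tendsto_const[of 1]]
  have "(\<lambda>n. (harm (Suc n) - ln (real (Suc n))) / ln (real (Suc n)) + 1) \<longlonglongrightarrow> (1 :: real)" by simp
  then show ?thesis
  proof (rule Lim_transform_eventually)
    show "\<forall>\<^sub>F n in sequentially. (harm (Suc n) - ln (real (Suc n))) / ln (real (Suc n)) + 1
        = harm (Suc n) / ln (real (Suc n))"
      using eventually_gt_at_top[of 0]
      by eventually_elim (simp add: diff_divide_distrib)
  qed
qed

text \<open>
  Weights \<open>1 / (j + 1)\<close> have total mass comparable to \<open>ln n\<close>, so the first \<open>N\<close> terms contribute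
  nothing in the limit and the others at most \<open>\<epsilon> / 2\<close>.
\<close>

lemma log_mean_null:
  assumes d: "d \<longlonglongrightarrow> (0 :: real)"
  shows "(\<lambda>n. (\<Sum>j<Suc n. d j / (real j + 1)) / ln (real (Suc n))) \<longlonglongrightarrow> 0"
proof (rule LIMSEQ_I)
  fix \<epsilon> :: real assume "\<epsilon> > 0"
  obtain N where N: "\<And>j. j \<ge> N \<Longrightarrow> \<bar>d j\<bar> < \<epsilon> / 2"
    using LIMSEQ_D[OF d, of "\<epsilon> / 2"] \<open>\<epsilon> > 0\<close> by auto
  define M where "M = (\<Sum>j<N. \<bar>d j\<bar> / (real j + 1))"
  have bound: "\<bar>\<Sum>j<n. d j / (real j + 1)\<bar> \<le> M + \<epsilon> / 2 * harm n" for n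
  proof -
    have "\<bar>\<Sum>j<n. d j / (real j + 1)\<bar> \<le> (\<Sum>j<n. \<bar>d j / (real j + 1)\<bar>)" by (rule sum_abs)
    also have "\<dots> \<le> (\<Sum>j<n. (if j < N then \<bar>d j\<bar> / (real j + 1) else 0) + \<epsilon> / 2 * (1 / (real j + 1)))"
    proof (rule sum_mono)
      fix j
      show "\<bar>d j / (real j + 1)\<bar>
          \<le> (if j < N then \<bar>d j\<bar> / (real j + 1) else 0) + \<epsilon> / 2 * (1 / (real j + 1))"
      proof (cases "j < N")
        case True
        then show ?thesis using \<open>\<epsilon> > 0\<close> by simp
      next
        case False
        then have "\<bar>d j\<bar> / (real j + 1) \<le> (\<epsilon> / 2) / (real j + 1)"
          using N[of j] by (intro divide_right_mono) auto
        then show ?thesis using False by simp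
      qed
    qed
    also have "\<dots> = (\<Sum>j<n. if j < N then \<bar>d j\<bar> / (real j + 1) else 0) + \<epsilon> / 2 * (\<Sum>j<n. 1 / (real j + 1))"
      by (simp add: sum.distrib sum_distrib_left)
    also have "(\<Sum>j<n. if j < N then \<bar>d j\<bar> / (real j + 1) else 0)
        = (\<Sum>j\<in>{..<n} \<inter> {..<N}. \<bar>d j\<bar> / (real j + 1))"
      by (subst sum.inter_restrict) (auto intro: sum.cong)
    also have "\<dots> \<le> M" unfolding M_def by (rule sum_mono2) auto
    also have "(\<Sum>j<n. 1 / (real j + 1)) = harm n"
      unfolding harm_def
      by (rule sum.reindex_bij_witness[of _ "\<lambda>j. j - 1" Suc]) (auto simp: inverse_eq_divide add.commute)
    finally show ?thesis by simp
  qed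
  have "(\<lambda>n. M / ln (real (Suc n)) + \<epsilon> / 2 * (harm (Suc n) / ln (real (Suc n)))) \<longlonglongrightarrow> 0 + \<epsilon> / 2 * 1"
    by (intro tendsto_intros harm_div_ln tendsto_divide_0[OF tendsto_const]
        filterlim_at_top_imp_at_infinity[OF filterlim_ln_Suc])
  then have "\<forall>\<^sub>F n in sequentially. M / ln (real (Suc n)) + \<epsilon> / 2 * (harm (Suc n) / ln (real (Suc n))) < \<epsilon>"
    by (rule order_tendstoD) (use \<open>\<epsilon> > 0\<close> in simp)
  then have "\<forall>\<^sub>F n in sequentially. norm ((\<Sum>j<Suc n. d j / (real j + 1)) / ln (real (Suc n)) - 0) < \<epsilon>"
  proof eventually_elim
    case (elim n)
    have "\<bar>\<Sum>j<Suc n. d j / (real j + 1)\<bar> / ln (real (Suc n)) \<le> (M + \<epsilon> / 2 * harm (Suc n)) / ln (real (Suc n))"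
      by (intro divide_right_mono bound) simp
    also have "\<dots> = M / ln (real (Suc n)) + \<epsilon> / 2 * (harm (Suc n) / ln (real (Suc n)))"
      by (simp add: add_divide_distrib)
    also note elim
    finally show ?case by (simp add: abs_divide del: sum.lessThan_Suc)
  qed
  then show "\<exists>N. \<forall>n\<ge>N. norm ((\<Sum>j<Suc n. d j / (real j + 1)) / ln (real (Suc n)) - 0) < \<epsilon>"
    by (simp only: eventually_sequentially)
qed

lemma log_mean:
  assumes a: "(\<lambda>j. (real j + 1) * a j) \<longlonglongrightarrow> L"
  shows "(\<lambda>n. (\<Sum>j<Suc n. a j) / ln (real (Suc n))) \<longlonglongrightarrow> L"
proof -
  define d where "d j = (real j + 1) * a j - L" for j
  have "d \<longlonglongrightarrow> 0" using a by (simp add: d_def[abs_def] LIM_zero)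
  then have "(\<lambda>n. (\<Sum>j<Suc n. d j / (real j + 1)) / ln (real (Suc n))
      + L * (harm (Suc n) / ln (real (Suc n)))) \<longlonglongrightarrow> 0 + L * 1"
    by (intro tendsto_intros log_mean_null harm_div_ln)
  moreover have "(\<Sum>j<n. a j) = (\<Sum>j<n. d j / (real j + 1)) + L * harm n" for n
  proof -
    have "harm n = (\<Sum>j<n. 1 / (real j + 1))"
      unfolding harm_def
      by (rule sum.reindex_bij_witness[of _ Suc "\<lambda>j. j - 1"]) (auto simp: inverse_eq_divide add.commute)
    then have "(\<Sum>j<n. d j / (real j + 1)) + L * harm n = (\<Sum>j<n. d j / (real j + 1) + L * (1 / (real j + 1)))"
      by (simp add: sum.distrib sum_distrib_left)
    also have "\<dots> = (\<Sum>j<n. a j)"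
      by (rule sum.cong) (simp_all add: d_def add_divide_distrib[symmetric])
    finally show ?thesis by simp
  qed
  ultimately show ?thesis by (simp add: add_divide_distrib del: sum.lessThan_Suc)
qed

section \<open>Strong measurability of the absolute value\<close>

theorem corollary5p13:
  fixes A :: "'a::chilbert_space \<Rightarrow> 'a"
  assumes "separable_space (euclidean :: 'a topology)"
    and "infinite_dimensional TYPE('a)"
    and "A \<in> weak_trace_class"
    and "convergent (\<lambda>j. real j * singular_value A j)"
  shows "strongly_measurable_op (abs_op A) \<and>
    measurable_op (abs_op A) \<and>
    nc_integral (abs_op A) = complex_of_real (lim (\<lambda>j. real j * singular_value A j))"
proof -
  have cpt: "compact_op A" and bigo: "singular_value A \<in> O(\<lambda>j. 1 / real j)"
    using assms(3) by (auto simp: weak_trace_class_def)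
  obtain e s where e: "orthonormal_seq e" and s: "decseq s" "\<And>k. s k \<ge> 0" "s \<longlonglongrightarrow> 0"
      and P: "abs_op A = diag_op e e s"
    using abs_op_compact_diagonal[OF assms(2) cpt] by blast
  have Bs: "Bseq s" using s(3) convergent_imp_Bseq convergent_def by blast
  have ev: "eigenvalue_seq (diag_op e e s) = (\<lambda>k. complex_of_real (s k))"
    by (rule eigenvalue_seq_diag_op[OF e s])
  have sv: "singular_value A = s"
    by (simp add: singular_value_def[abs_def] P ev)
  have sv': "singular_value (diag_op e e s) = s"
    by (simp add: singular_value_def[abs_def] abs_op_diag_op[OF e e Bs s(2)] ev)
  have wtc: "diag_op e e s \<in> weak_trace_class"
    using bigo by (simp add: weak_trace_class_def compact_op_diag_op[OF e e s(3)] sv sv')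
  define L where "L = lim (\<lambda>j. real j * s j)"
  have "(\<lambda>j. real j * s j) \<longlonglongrightarrow> L"
    using assms(4) by (simp add: sv L_def convergent_LIMSEQ_iff)
  from tendsto_add[OF this s(3)] have lim: "(\<lambda>j. (real j + 1) * s j) \<longlonglongrightarrow> L"
    by (simp add: distrib_right)
  have "strongly_measurable_op (diag_op e e s)"
    unfolding strongly_measurable_op_def
    using wtc positive_normalized_trace_diag_op[OF assms(2) _ _ e s(2) lim] by blast
  moreover have dix: "dixmier_trace \<omega> (diag_op e e s) = complex_of_real L" if "extended_limit \<omega>" for \<omega>
    unfolding dixmier_trace_def ev
  proof (rule extended_limit_convergent[OF that])
    show "(\<lambda>n. complex_of_real (1 / ln (real (Suc n))) * (\<Sum>j<Suc n. complex_of_real (s j)))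
        \<longlonglongrightarrow> complex_of_real L"
      using tendsto_of_real[OF log_mean[OF lim], where 'a = complex] by (simp add: field_simps)
  qed
  then have "measurable_op (diag_op e e s)" unfolding measurable_op_def using wtc by blast
  moreover have "nc_integral (diag_op e e s) = complex_of_real L"
    unfolding nc_integral_def
    by (rule the_equality) (use dix extended_limit_exists in \<open>blast, metis\<close>)
  ultimately show ?thesis by (simp add: P sv L_def)
qed

end
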